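(* Fix $F>0$, $E\in\mathbb{R}$, $\alpha\ge0$, $\beta>0$, $\mu>0$, $C>0$, and let $h:\mathbb{N}\to\mathbb{R}$ satisfy $|h(n+1)-h(n)|\le Cn^{-\beta}$ for all integers $n\in[x_l,x_{l+1}]$. Then for all sufficiently large $l$ and all $x_l\le a<b\le x_{l+1}$, $$\Bigl|\sum_{a<n\le b}\frac{e^{i(\mu\gamma(n)+h(n))}}{\gamma'(n)^\alpha}\Bigr|\lesssim l^{-\alpha+1/2}\bigl(1+l^{1-2\beta}\bigr),$$ with implicit constant uniform for $E,F,\alpha,\beta,\mu,C$ in compact subsets of their domains.
   Context: The reference solution is $\zeta(x)=(\pi/F^{1/3})^{1/2}\bigl(i\,\mathrm{Ai}(-F^{1/3}(x+E/F))+\mathrm{Bi}(-F^{1/3}(x+E/F))\bigr)$ (Airy functions); it has no real zeros and $\gamma\in C^\infty(\mathbb{R})$ is the real function with $\zeta=|\zeta|e^{i\gamma}$, $\gamma(0)\in(-\pi,\pi]$. For $l\in\mathbb{N}$, $x_l=\bigl\lceil\frac{\pi^2}{F}(l-\frac12)^2\bigr\rceil-\frac12$; sums are over integers $n$. *)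

theory Defs
  imports "HOL-Analysis.Analysis"
begin

text \<open>Airy functions via their Maclaurin series (DLMF 9.4.1--9.4.2):
  Ai = Ai(0) f + Ai'(0) g,  Bi = sqrt 3 (Ai(0) f - Ai'(0) g), with
  f(x) = sum 3^k (1/3)_k x^(3k)/(3k)!,  g(x) = sum 3^k (2/3)_k x^(3k+1)/(3k+1)!,
  Ai(0) = 1/(3^(2/3) Gamma(2/3)),  Ai'(0) = -1/(3^(1/3) Gamma(1/3)).\<close>

definition airy_f :: "real \<Rightarrow> real" where
  "airy_f x = (\<Sum>k. 3 ^ k * pochhammer (1/3) k * x ^ (3 * k) / fact (3 * k))"

definition airy_g :: "real \<Rightarrow> real" where
  "airy_g x = (\<Sum>k. 3 ^ k * pochhammer (2/3) k * x ^ (3 * k + 1) / fact (3 * k + 1))"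

definition airy_c1 :: real where
  "airy_c1 = 1 / (3 powr (2/3) * Gamma (2/3))"

definition airy_c2 :: real where
  "airy_c2 = 1 / (3 powr (1/3) * Gamma (1/3))"

definition Airy_Ai :: "real \<Rightarrow> real" where
  "Airy_Ai x = airy_c1 * airy_f x - airy_c2 * airy_g x"

definition Airy_Bi :: "real \<Rightarrow> real" where
  "Airy_Bi x = sqrt 3 * (airy_c1 * airy_f x + airy_c2 * airy_g x)"

definition zeta_ref :: "real \<Rightarrow> real \<Rightarrow> real \<Rightarrow> complex" where
  "zeta_ref F E x =
     complex_of_real (sqrt (pi / F powr (1/3))) *
     (\<i> * complex_of_real (Airy_Ai (- (F powr (1/3)) * (x + E / F)))
      + complex_of_real (Airy_Bi (- (F powr (1/3)) * (x + E / F))))"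

definition gamma_phase :: "real \<Rightarrow> real \<Rightarrow> real \<Rightarrow> real" where
  "gamma_phase F E = (THE g. continuous_on UNIV g \<and>
      (\<forall>x. zeta_ref F E x = complex_of_real (cmod (zeta_ref F E x)) * cis (g x)) \<and>
      - pi < g 0 \<and> g 0 \<le> pi)"

definition x_pt :: "real \<Rightarrow> nat \<Rightarrow> real" where
  "x_pt F l = real_of_int \<lceil>pi\<^sup>2 / F * (real l - 1/2)\<^sup>2\<rceil> - 1/2"

end

theory Submission
  imports Defs
begin

text \<open>
  The modulus of the reference solution has a Laplace representation,
  \<open>\<pi> (Ai(-t)\<^sup>2 + Bi(-t)\<^sup>2) = \<pi>\<^sup>-\<^sup>1\<^sup>/\<^sup>2 \<integral>\<^sub>0\<^sup>\<infinity> s\<^sup>-\<^sup>1\<^sup>/\<^sup>2 exp(- t s - s\<^sup>3/12) ds\<close>, which shows without any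
  asymptotic expansion that it is decreasing and comparable to \<open>t\<^sup>-\<^sup>1\<^sup>/\<^sup>2\<close>, with increments comparable
  to those of \<open>t\<^sup>-\<^sup>1\<^sup>/\<^sup>2\<close>. As the Wronskian of \<open>Ai\<close> and \<open>Bi\<close> is constant, \<open>\<gamma>' = 1 / |\<zeta>|\<^sup>2\<close>; hence on the
  \<open>l\<close>-th block \<open>\<gamma>' \<ge> l\<close>, the second differences of \<open>\<gamma>\<close> are of order \<open>1/l\<close>, and \<open>\<gamma>'\<close> grows by
  \<open>O(1)\<close> in total. Van der Corput's second derivative test gives \<open>O(l\<^sup>1\<^sup>/\<^sup>2)\<close> for the sums of
  \<open>exp(i \<mu> \<gamma>(n))\<close>, and summation by parts absorbs the factor \<open>exp(i h(n)) \<gamma>'(n)\<^sup>-\<^sup>\<alpha>\<close>, whose total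
  variation is \<open>O(l\<^sup>-\<^sup>\<alpha> (1 + l\<^sup>1\<^sup>-\<^sup>2\<^sup>\<beta>))\<close>.
\<close>

section \<open>Exponential sums with monotone phase differences\<close>

lemma sum_mult_by_parts:
  fixes u v :: "nat \<Rightarrow> 'a::comm_ring_1"
  assumes "m \<le> N"
  shows "(\<Sum>k\<in>{m..<Suc N}. u k * v k) =
    (\<Sum>k\<in>{m..<Suc N}. u k) * v N - (\<Sum>k\<in>{m..<N}. (\<Sum>i\<in>{m..<Suc k}. u i) * (v (Suc k) - v k))"
  using assms
proof (induction N rule: dec_induct)
  case (step N)
  then show ?case by (simp add: algebra_simps)
qed simp

text \<open>Abel summation: a uniform bound on the partial sums of \<open>u\<close> costs only the
  last weight plus the total variation of \<open>v\<close>. It serves twice: for the Kuzmin-Landau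
  inequality, and for absorbing \<open>h\<close> and the power of the phase derivative.\<close>

lemma norm_sum_mult_le:
  fixes u v :: "nat \<Rightarrow> complex"
  assumes "m \<le> N" and U: "\<And>n. m \<le> n \<Longrightarrow> n \<le> N \<Longrightarrow> norm (\<Sum>k\<in>{m..<Suc n}. u k) \<le> U"
  shows "norm (\<Sum>k\<in>{m..<Suc N}. u k * v k) \<le>
    U * (norm (v N) + (\<Sum>k\<in>{m..<N}. norm (v (Suc k) - v k)))"
proof -
  have "norm (\<Sum>k\<in>{m..<Suc N}. u k * v k) \<le> norm ((\<Sum>k\<in>{m..<Suc N}. u k) * v N)
     + norm (\<Sum>k\<in>{m..<N}. (\<Sum>i\<in>{m..<Suc k}. u i) * (v (Suc k) - v k))"
    unfolding sum_mult_by_parts[OF assms(1)] by (rule norm_triangle_ineq4)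
  also have "\<dots> \<le> U * norm (v N) + (\<Sum>k\<in>{m..<N}. U * norm (v (Suc k) - v k))"
  proof (intro add_mono sum_norm_le)
    show "norm ((\<Sum>k\<in>{m..<Suc N}. u k) * v N) \<le> U * norm (v N)"
      unfolding norm_mult by (intro mult_right_mono U assms) auto
    fix k assume "k \<in> {m..<N}"
    then show "norm ((\<Sum>i\<in>{m..<Suc k}. u i) * (v (Suc k) - v k)) \<le> U * norm (v (Suc k) - v k)"
      unfolding norm_mult by (intro mult_right_mono U) auto
  qed
  finally show ?thesis by (simp add: sum_distrib_left algebra_simps)
qed

section \<open>The Kuzmin-Landau inequality\<close>

text \<open>On \<open>{0..pi/2}\<close> the concave sine lies above its chord, so
  \<open>2 * y / pi \<le> sin y\<close>; arguments beyond \<open>pi / 2\<close> are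
  reflected.\<close>

lemma sin_ge_of_gap:
  assumes "0 < \<theta>" "\<theta> \<le> pi" "\<theta> / 2 \<le> x" "x \<le> pi - \<theta> / 2"
  shows "\<theta> / pi \<le> sin x"
proof -
  have *: "2 * y / pi \<le> sin y" if "0 \<le> y" "y \<le> pi / 2" for y
  proof -
    have "concave_on {0..pi} sin"
      unfolding concave_on_def
      by (rule f''_ge0_imp_convex[where f' = "\<lambda>x. - cos x" and f'' = "\<lambda>x. sin x"])
         (auto intro!: derivative_eq_intros sin_ge_zero)
    from concave_onD[OF this, of "2*y/pi" 0 "pi/2"] show ?thesis
      using that by (simp add: field_simps)
  qed
  show ?thesis
  proof (cases "x \<le> pi / 2")
    case True
    have "\<theta> / pi \<le> 2 * x / pi" using assms by (simp add: field_simps)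
    with *[of x] True assms show ?thesis by simp
  next
    case False
    have "\<theta> / pi \<le> 2 * (pi - x) / pi" using assms by (simp add: field_simps)
    with *[of "pi - x"] False assms show ?thesis by simp
  qed
qed

lemma cot_diff: "sin x \<noteq> 0 \<Longrightarrow> sin y \<noteq> 0 \<Longrightarrow> cot x - cot y = sin (y - x) / (sin x * sin y)" for x y :: real
  by (simp add: cot_def sin_diff field_simps)

lemma cot_antimono:
  assumes "0 < x" "x \<le> y" "y < pi" shows "cot y \<le> cot (x::real)"
proof -
  have "0 < sin x" "0 < sin y" using assms by (auto intro!: sin_gt_zero)
  moreover have "0 \<le> sin (y - x)" using assms by (intro sin_ge_zero) auto
  ultimately show ?thesis using cot_diff[of x y] by (smt (verit) divide_nonneg_pos mult_pos_pos)
qed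

lemma inverse_cis_minus_1:
  assumes "sin (x/2) \<noteq> 0"
  shows "inverse (cis x - 1) = Complex (- 1/2) (- cot (x/2) / 2)"
proof -
  have c: "cis x = Complex (1 - 2 * (sin (x/2))\<^sup>2) (2 * sin (x/2) * cos (x/2))"
    using sin_double[of "x/2"] cos_double_sin[of "x/2"] by (simp add: cis.ctr)
  have "Complex (- 1/2) (- cot (x/2) / 2) * (cis x - 1) = Complex ((sin (x/2))\<^sup>2 + (cos (x/2))\<^sup>2) 0"
    using assms unfolding c cot_def
    by (simp add: complex_eq_iff power2_eq_square del: sin_cos_squared_add sin_cos_squared_add2 sin_cos_squared_add3)
  also have "\<dots> = 1" by (simp add: complex_eq_iff)
  finally have "(cis x - 1) * Complex (- 1/2) (- cot (x/2) / 2) = 1" by (simp only: mult.commute)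
  then show ?thesis by (rule inverse_unique)
qed

text \<open>Summation by parts against a telescoping \<open>u\<close>, whose partial sums have norm
  at most 2. The last weight is at most \<open>pi / (2 * \<theta>)\<close>, the variation of the
  weights is half a difference of two cotangents and so at most \<open>pi / \<theta>\<close>;
  doubling the total gives the constant 3. The value \<open>\<phi> N\<close> just past the range
  enters through the last difference.\<close>

lemma kuzmin_landau_aux:
  fixes \<phi> :: "nat \<Rightarrow> real"
  assumes \<theta>: "0 < \<theta>" "\<theta> \<le> pi"
    and mono: "\<And>n. m \<le> n \<Longrightarrow> Suc n < N \<Longrightarrow> \<phi> (Suc n) - \<phi> n \<le> \<phi> (Suc (Suc n)) - \<phi> (Suc n)"
    and gap: "\<And>n. m \<le> n \<Longrightarrow> n < N \<Longrightarrow> \<theta> \<le> \<phi> (Suc n) - \<phi> n \<and> \<phi> (Suc n) - \<phi> n \<le> 2 * pi - \<theta>"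
  shows "norm (\<Sum>n\<in>{m..<N}. cis (\<phi> n)) \<le> 3 * pi / \<theta>"
proof (cases "m < N")
  case True
  then obtain M where M: "N = Suc M" "m \<le> M" by (cases N) auto
  define \<delta> where "\<delta> = (\<lambda>n. \<phi> (Suc n) - \<phi> n)"
  define u where "u = (\<lambda>n. cis (\<phi> (Suc n)) - cis (\<phi> n))"
  define v where "v = (\<lambda>n. inverse (cis (\<delta> n) - 1))"
  have sin_ge: "\<theta> / pi \<le> sin (\<delta> n / 2)" if "m \<le> n" "n < N" for n
    using gap[OF that] \<theta> by (intro sin_ge_of_gap) (auto simp: \<delta>_def)
  have sin_pos: "0 < sin (\<delta> n / 2)" if "m \<le> n" "n < N" for n
    using sin_ge[OF that] \<theta> by (smt (verit) divide_pos_pos pi_gt_zero)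
  have v_eq: "v n = Complex (- 1/2) (- cot (\<delta> n/2) / 2)" if "m \<le> n" "n < N" for n
    unfolding v_def using sin_pos[OF that] by (intro inverse_cis_minus_1) simp
  have inv_sin: "1 / sin (\<delta> n / 2) \<le> pi / \<theta>" if "m \<le> n" "n < N" for n
    using sin_ge[OF that] sin_pos[OF that] \<theta> by (simp add: field_simps)
  have cot_le: "\<bar>cot (\<delta> n / 2)\<bar> \<le> pi / \<theta>" if "m \<le> n" "n < N" for n
  proof -
    have "\<bar>cot (\<delta> n / 2)\<bar> \<le> 1 / sin (\<delta> n / 2)"
      using sin_pos[OF that] abs_cos_le_one[of "\<delta> n / 2"] by (simp add: cot_def abs_divide divide_right_mono)
    with inv_sin[OF that] show ?thesis by simp
  qed
  \<comment> \<open>Each term is a difference divided by \<open>cis (\<delta> n) - 1\<close>, whose inverse has real part \<open>-1/2\<close>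
    and monotone imaginary part, so its total variation telescopes.\<close>
  have uv: "cis (\<phi> n) = u n * v n" if "m \<le> n" "n < N" for n
  proof -
    have "cis (\<delta> n) \<noteq> 1"
    proof
      assume a: "cis (\<delta> n) = 1"
      have "cis (\<delta> n / 2) * cis (\<delta> n / 2) = 1" using a by (simp add: cis_mult)
      then have "cis (\<delta> n / 2) = 1 \<or> cis (\<delta> n / 2) = -1"
        by (metis square_eq_1_iff)
      then have "sin (\<delta> n / 2) = 0" by (auto simp: complex_eq_iff)
      then show False using sin_pos[OF that] by simp
    qed
    moreover have "u n = cis (\<phi> n) * (cis (\<delta> n) - 1)"
      by (simp add: u_def \<delta>_def algebra_simps cis_mult)
    ultimately show ?thesis by (simp add: v_def)
  qed
  have "(\<Sum>n\<in>{m..<N}. cis (\<phi> n)) = (\<Sum>n\<in>{m..<Suc M}. u n * v n)"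
    unfolding M(1)[symmetric] by (rule sum.cong) (auto simp: uv)
  also have "norm \<dots> \<le> 2 * (norm (v M) + (\<Sum>k\<in>{m..<M}. norm (v (Suc k) - v k)))"
  proof (rule norm_sum_mult_le[OF M(2)])
    fix n assume n: "m \<le> n" "n \<le> M"
    have "(\<Sum>k\<in>{m..<Suc n}. u k) = cis (\<phi> (Suc n)) - cis (\<phi> m)"
      unfolding u_def using n by (intro sum_Suc_diff') simp
    then show "norm (\<Sum>k\<in>{m..<Suc n}. u k) \<le> 2"
      using norm_triangle_ineq4[of "cis (\<phi> (Suc n))" "cis (\<phi> m)"] by simp
  qed
  also have "(\<Sum>k\<in>{m..<M}. norm (v (Suc k) - v k)) = (\<Sum>k\<in>{m..<M}. - (cot (\<delta> (Suc k) / 2) / 2) - - (cot (\<delta> k / 2) / 2))"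
  proof (rule sum.cong)
    fix k assume k: "k \<in> {m..<M}"
    have "cot (\<delta> (Suc k) / 2) \<le> cot (\<delta> k / 2)"
      using k gap[of k] gap[of "Suc k"] mono[of k] M \<theta>
      by (intro cot_antimono) (auto simp: \<delta>_def)
    moreover have "v (Suc k) - v k = Complex 0 ((cot (\<delta> k / 2) - cot (\<delta> (Suc k) / 2)) / 2)"
      using k M by (subst (1 2) v_eq) (auto simp: complex_eq_iff field_simps)
    then have "norm (v (Suc k) - v k) = \<bar>(cot (\<delta> k / 2) - cot (\<delta> (Suc k) / 2)) / 2\<bar>"
      by (simp add: complex_norm)
    ultimately show "norm (v (Suc k) - v k) = - (cot (\<delta> (Suc k) / 2) / 2) - - (cot (\<delta> k / 2) / 2)"
      by simp
  qed auto
  also have "\<dots> = - (cot (\<delta> M / 2) / 2) + (cot (\<delta> m / 2) / 2)"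
    using sum_Suc_diff'[OF M(2), of "\<lambda>k. - (cot (\<delta> k / 2) / 2)"] by simp
  also have "norm (v M) \<le> pi / \<theta> / 2"
  proof -
    have "cmod (v M) = 1 / (2 * sin (\<delta> M / 2))"
    proof -
      have "(norm (v M))\<^sup>2 = (1 / (2 * sin (\<delta> M / 2)))\<^sup>2"
      proof -
        have "(norm (v M))\<^sup>2 = (1/2)\<^sup>2 + (cot (\<delta> M / 2) / 2)\<^sup>2"
          using M by (simp only: cmod_power2) (simp add: v_eq)
        also have "\<dots> = ((sin (\<delta> M / 2))\<^sup>2 + (cos (\<delta> M / 2))\<^sup>2) / (2 * sin (\<delta> M / 2))\<^sup>2"
          using sin_pos[of M] M by (simp add: cot_def field_simps)
        finally show ?thesis by (simp add: power_divide)
      qed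
      then show ?thesis using sin_pos[of M] M by (simp add: power2_eq_iff_nonneg)
    qed
    then show ?thesis using inv_sin[of M] M by simp
  qed
  finally have "norm (\<Sum>n\<in>{m..<N}. cis (\<phi> n)) \<le> 2 * (pi / \<theta> / 2 + (- (cot (\<delta> M / 2) / 2) + (cot (\<delta> m / 2) / 2)))"
    by simp
  then show ?thesis using cot_le[of M] cot_le[of m] M True by simp
qed (use \<theta> in simp)

lemma cis_minus_2pi_int: "cis (x - 2 * pi * of_int j * of_nat n) = cis x"
proof -
  have "cis (x - 2 * pi * of_int j * of_nat n) = cis (x + 2 * pi * of_int (- j * int n))"
    by (simp add: algebra_simps)
  also have "\<dots> = cis x * cis (2 * pi * of_int (- j * int n))"
    by (simp only: cis_mult)
  also have "\<dots> = cis x" by (subst cis_multiple_2pi) auto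
  finally show ?thesis .
qed

text \<open>Subtracting the linear phase \<open>2 * pi * j * n\<close> changes no term at an integer
  \<open>n\<close>, but moves the differences into the base period of
  \<open>kuzmin_landau_aux\<close>.\<close>

lemma kuzmin_landau:
  fixes \<phi> :: "nat \<Rightarrow> real" and j :: int
  assumes \<theta>: "0 < \<theta>" "\<theta> \<le> pi"
    and mono: "\<And>n. m \<le> n \<Longrightarrow> Suc n < N \<Longrightarrow> \<phi> (Suc n) - \<phi> n \<le> \<phi> (Suc (Suc n)) - \<phi> (Suc n)"
    and gap: "\<And>n. m \<le> n \<Longrightarrow> n < N \<Longrightarrow>
       2 * pi * j + \<theta> \<le> \<phi> (Suc n) - \<phi> n \<and> \<phi> (Suc n) - \<phi> n \<le> 2 * pi * (j + 1) - \<theta>"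
  shows "norm (\<Sum>n\<in>{m..<N}. cis (\<phi> n)) \<le> 3 * pi / \<theta>"
proof -
  have "norm (\<Sum>n\<in>{m..<N}. cis (\<phi> n - 2 * pi * of_int j * of_nat n)) \<le> 3 * pi / \<theta>"
  proof (rule kuzmin_landau_aux[OF \<theta>])
    fix n assume "m \<le> n" "Suc n < N"
    from mono[OF this] show "\<phi> (Suc n) - 2 * pi * of_int j * of_nat (Suc n) - (\<phi> n - 2 * pi * of_int j * of_nat n) \<le>
       \<phi> (Suc (Suc n)) - 2 * pi * of_int j * of_nat (Suc (Suc n)) - (\<phi> (Suc n) - 2 * pi * of_int j * of_nat (Suc n))"
      by (simp add: algebra_simps)
  next
    fix n assume "m \<le> n" "n < N"
    from gap[OF this] show "\<theta> \<le> \<phi> (Suc n) - 2 * pi * of_int j * of_nat (Suc n) - (\<phi> n - 2 * pi * of_int j * of_nat n) \<and>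
       \<phi> (Suc n) - 2 * pi * of_int j * of_nat (Suc n) - (\<phi> n - 2 * pi * of_int j * of_nat n) \<le> 2 * pi - \<theta>"
      by (simp add: algebra_simps)
  qed
  then show ?thesis by (simp only: cis_minus_2pi_int)
qed

section \<open>Van der Corput's second derivative test\<close>

lemma spaced_ge:
  fixes \<delta> :: "nat \<Rightarrow> real"
  assumes sp: "\<And>n. m \<le> n \<Longrightarrow> Suc n < N \<Longrightarrow> \<delta> n + \<kappa> \<le> \<delta> (Suc n)"
    and "m \<le> p" "p \<le> q" "q < N"
  shows "\<delta> p + \<kappa> * (real q - real p) \<le> \<delta> q"
  using assms(3,4)
proof (induction q rule: dec_induct)
  case (step q)
  then show ?case using sp[of q] assms(2) by (simp add: algebra_simps)
qed simp

text \<open>By the spacing, the least and the greatest admissible index differ by at most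
  \<open>(b - a) / \<kappa>\<close>, and all admissible indices lie between them.\<close>

lemma card_spaced_le:
  fixes \<delta> :: "nat \<Rightarrow> real"
  assumes sp: "\<And>n. m \<le> n \<Longrightarrow> Suc n < N \<Longrightarrow> \<delta> n + \<kappa> \<le> \<delta> (Suc n)"
    and "0 < \<kappa>" "a \<le> b"
  shows "card {n\<in>{m..<N}. a \<le> \<delta> n \<and> \<delta> n \<le> b} \<le> (b - a) / \<kappa> + 1"
proof -
  let ?S = "{n\<in>{m..<N}. a \<le> \<delta> n \<and> \<delta> n \<le> b}"
  show ?thesis
  proof (cases "?S = {}")
    case False
    have fin: "finite ?S" by simp
    define p q where "p = Min ?S" and "q = Max ?S"
    have "p \<in> ?S" "q \<in> ?S" unfolding p_def q_def using Min_in[OF fin False] Max_in[OF fin False] by blast+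
    moreover have "p \<le> q" unfolding p_def using \<open>q \<in> ?S\<close> by (intro Min_le) auto
    ultimately have "\<kappa> * (real q - real p) \<le> b - a" using spaced_ge[of m N \<delta> \<kappa> p q, OF sp] by auto
    then have "real q - real p \<le> (b - a) / \<kappa>" using assms(2) by (simp add: field_simps)
    moreover have "?S \<subseteq> {p..q}" unfolding p_def q_def using fin by (auto intro!: Min_le Max_ge)
    then have "card ?S \<le> Suc q - p" using card_mono[of "{p..q}" ?S] by simp
    ultimately show ?thesis using \<open>p \<le> q\<close> by linarith
  next
    case True
    show ?thesis using assms unfolding True by simp
  qed
qed

text \<open>Split the range by the multiple of \<open>2 \<pi>\<close> just below the phase difference. In each part
  few terms have a difference within \<open>\<surd>\<kappa>\<close> of a multiple of \<open>2 \<pi>\<close>, because the differences are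
  \<open>\<kappa>\<close>-spaced; the remaining terms form an interval covered by the Kuzmin--Landau inequality.\<close>

lemma van_der_corput:
  fixes \<phi> :: "nat \<Rightarrow> real"
  defines "\<delta> \<equiv> \<lambda>n. \<phi> (Suc n) - \<phi> n"
  assumes sp: "\<And>n. m \<le> n \<Longrightarrow> Suc n < N \<Longrightarrow> \<delta> n + \<kappa> \<le> \<delta> (Suc n)"
    and D: "\<And>n. m \<le> n \<Longrightarrow> n < N \<Longrightarrow> \<delta> n \<le> \<delta> m + D"
    and D0: "0 \<le> D" and \<kappa>: "0 < \<kappa>" "\<kappa> \<le> 1"
  shows "norm (\<Sum>n\<in>{m..<N}. cis (\<phi> n)) \<le> 16 * (D + 2) / sqrt \<kappa>"
proof (cases "m < N")
  case False
  then show ?thesis using D0 \<kappa> by simp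
next
  case True
  \<comment> \<open>This width balances two costs: about \<open>\<theta> / \<kappa>\<close>
    discarded terms near each end of a period, and \<open>3 * pi / \<theta>\<close> for the
    remaining ones. Both become of order \<open>1 / \<theta>\<close>.\<close>
  define \<theta> where "\<theta> = sqrt \<kappa>"
  have \<theta>: "0 < \<theta>" "\<theta> \<le> 1" using \<kappa> by (auto simp: \<theta>_def)
  have mono: "\<delta> p \<le> \<delta> q" if "m \<le> p" "p \<le> q" "q < N" for p q
    using spaced_ge[of m N \<delta> \<kappa> p q, OF sp that] \<kappa> that by (smt (verit) mult_nonneg_nonneg of_nat_mono)
  define J where "J = {\<lfloor>\<delta> m / (2*pi)\<rfloor>..\<lfloor>(\<delta> m + D) / (2*pi)\<rfloor>}"
  define F where "F = (\<lambda>j. {n\<in>{m..<N}. \<lfloor>\<delta> n / (2*pi)\<rfloor> = j})"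
  have F: "2 * pi * j \<le> \<delta> n" "\<delta> n < 2 * pi * (j + 1)" if "n \<in> F j" for n and j :: int
    using that unfolding F_def by (auto simp: floor_eq_iff field_simps)
  have "(\<Sum>n\<in>{m..<N}. cis (\<phi> n)) = (\<Sum>j\<in>J. \<Sum>n\<in>F j. cis (\<phi> n))"
    unfolding F_def
  proof (rule sum.group[symmetric])
    show "(\<lambda>n. \<lfloor>\<delta> n / (2*pi)\<rfloor>) ` {m..<N} \<subseteq> J"
      unfolding J_def using mono[of m] D by (auto intro!: floor_mono divide_right_mono)
  qed (auto simp: J_def)
  \<comment> \<open>The 16 is 4 for the terms near the ends of the period plus 12 for
    \<open>3 * pi\<close>, as \<open>pi < 4\<close>.\<close>
  also have "norm \<dots> \<le> (\<Sum>j\<in>J. 16 / \<theta>)"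
  proof (rule sum_norm_le)
    fix j :: int
    define B where "B = {n\<in>{m..<N}. 2 * pi * j + \<theta> \<le> \<delta> n \<and> \<delta> n \<le> 2 * pi * (j + 1) - \<theta>}"
    define S1 where "S1 = {n\<in>{m..<N}. 2 * pi * j \<le> \<delta> n \<and> \<delta> n \<le> 2 * pi * j + \<theta>}"
    define S2 where "S2 = {n\<in>{m..<N}. 2 * pi * (j + 1) - \<theta> \<le> \<delta> n \<and> \<delta> n \<le> 2 * pi * (j + 1)}"
    have fin: "finite (F j)" "finite S1" "finite S2" "finite B" by (auto simp: F_def S1_def S2_def B_def)
    have BF: "B \<subseteq> F j" using \<theta> by (auto simp: B_def F_def floor_eq_iff field_simps)
    have "F j - B \<subseteq> S1 \<union> S2"
      using F[of _ j] unfolding S1_def S2_def B_def F_def by fastforce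
    then have "card (F j - B) \<le> card (S1 \<union> S2)" using fin by (intro card_mono) auto
    also have "\<dots> \<le> card S1 + card S2" by (rule card_Un_le)
    finally have "real (card (F j - B)) \<le> real (card S1) + real (card S2)" by linarith
    also have "\<dots> \<le> 2 * (\<theta> / \<kappa> + 1)"
    proof -
      have "card S1 \<le> \<theta> / \<kappa> + 1"
        using card_spaced_le[of m N \<delta> \<kappa>, OF sp \<kappa>(1), of "2*pi*j" "2*pi*j + \<theta>"] \<theta> by (simp add: S1_def)
      moreover have "card S2 \<le> \<theta> / \<kappa> + 1"
        using card_spaced_le[of m N \<delta> \<kappa>, OF sp \<kappa>(1), of "2*pi*(j+1)-\<theta>" "2*pi*(j+1)"] \<theta> by (simp add: S2_def)
      ultimately show ?thesis unfolding mult_2 by (rule add_mono)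
    qed
    also have "\<dots> \<le> 4 / \<theta>"
    proof -
      have "\<theta> / \<kappa> = 1 / \<theta>" unfolding \<theta>_def using \<kappa> by (simp add: field_simps)
      moreover have "1 \<le> 1 / \<theta>" using \<theta> by simp
      ultimately show ?thesis by simp
    qed
    finally have c: "card (F j - B) \<le> 4 / \<theta>" .
    have "norm (\<Sum>n\<in>B. cis (\<phi> n)) \<le> 3 * pi / \<theta>"
    proof (cases "B = {}")
      case False
      define p q where "p = Min B" and "q = Max B"
      have pq: "p \<in> B" "q \<in> B" unfolding p_def q_def using fin False by auto
      have "p \<le> n \<and> n \<le> q" if "n \<in> B" for n using that fin unfolding p_def q_def by auto
      \<comment> \<open>Monotone differences make \<open>B\<close> a set of consecutive integers, as
        Kuzmin-Landau requires.\<close>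
      moreover have "n \<in> B" if "p \<le> n" "n \<le> q" for n
        using that pq mono[of p n] mono[of n q] unfolding B_def by auto
      ultimately have Beq: "B = {p..<Suc q}" by (auto simp: less_Suc_eq_le)
      have B': "m \<le> n" "n < N" if "p \<le> n" "n < Suc q" for n
        using that pq by (auto simp: B_def)
      have Bn: "n \<in> B" if "p \<le> n" "n < Suc q" for n unfolding Beq using that by simp
      show ?thesis unfolding Beq
      proof (rule kuzmin_landau[where j = j])
        show "\<theta> \<le> pi" using \<theta> pi_gt3 by linarith
        fix n assume n: "p \<le> n" "n < Suc q"
        from Bn[OF n] show "2 * pi * j + \<theta> \<le> \<phi> (Suc n) - \<phi> n \<and> \<phi> (Suc n) - \<phi> n \<le> 2 * pi * (j + 1) - \<theta>"
          by (simp add: B_def \<delta>_def)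
      next
        fix n assume n: "p \<le> n" "Suc n < Suc q"
        then show "\<phi> (Suc n) - \<phi> n \<le> \<phi> (Suc (Suc n)) - \<phi> (Suc n)"
          using mono[of n "Suc n"] B'[of "Suc n"] B'[of n] unfolding \<delta>_def by auto
      qed (use \<theta> in auto)
    qed (use \<theta> in simp)
    moreover have "3 * pi / \<theta> \<le> 12 / \<theta>" using \<theta> pi_less_4 by (intro divide_right_mono) auto
    moreover have "norm (\<Sum>n\<in>F j - B. cis (\<phi> n)) \<le> 4 / \<theta>"
      using norm_sum[of "\<lambda>n. cis (\<phi> n)" "F j - B"] c by simp
    moreover have "(\<Sum>n\<in>F j. cis (\<phi> n)) = (\<Sum>n\<in>F j - B. cis (\<phi> n)) + (\<Sum>n\<in>B. cis (\<phi> n))"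
      using fin BF by (metis sum.subset_diff)
    ultimately show "norm (\<Sum>n\<in>F j. cis (\<phi> n)) \<le> 16 / \<theta>"
      using norm_triangle_ineq[of "\<Sum>n\<in>F j - B. cis (\<phi> n)" "\<Sum>n\<in>B. cis (\<phi> n)"] by simp
  qed
  also have "\<dots> = card J * (16 / \<theta>)" by simp
  also have "\<dots> \<le> (D + 2) * (16 / \<theta>)"
  proof (rule mult_right_mono)
    have "real_of_int (\<lfloor>(\<delta> m + D) / (2*pi)\<rfloor> - \<lfloor>\<delta> m / (2*pi)\<rfloor> + 1) \<le> (\<delta> m + D) / (2*pi) - (\<delta> m / (2*pi) - 1) + 1"
      by linarith
    also have "\<dots> = D / (2 * pi) + 2" by (simp add: field_simps)
    also have "\<dots> \<le> D + 2" using D0 pi_gt3 by (simp add: field_simps mult_le_cancel_left1)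
    finally show "real (card J) \<le> D + 2"
      unfolding J_def using D0 by auto
  qed (use \<theta> in simp)
  finally show ?thesis by (simp add: \<theta>_def mult.commute)
qed

section \<open>Power series of the Airy functions\<close>

text \<open>Indices 0 and 1 give the two solutions called \<open>f\<close> and \<open>g\<close> in DLMF 9.4.\<close>

definition airy_fps :: "nat \<Rightarrow> real fps" where
  "airy_fps e = Abs_fps (\<lambda>n. if n mod 3 = e
     then 3 ^ (n div 3) * pochhammer (real (Suc e) / 3) (n div 3) / fact n else 0)"

lemma airy_fps_nth_reindex:
  "e < 3 \<Longrightarrow> fps_nth (airy_fps e) (3 * k + e) = 3 ^ k * pochhammer (real (Suc e) / 3) k / fact (3 * k + e)"
  by (simp add: airy_fps_def)

text \<open>The Airy equation y'' = x y for formal series. Passing from \<open>k\<close> to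
  \<open>Suc k\<close>, the new Pochhammer factor times 3 is \<open>m + 1\<close> and cancels one of
  the three new factors of the factorial. At the constant term the coefficient of index 2 has to
  vanish, which is where \<open>e < 2\<close> matters.\<close>

lemma airy_fps_ode:
  assumes "e < 2"
  shows "fps_deriv (fps_deriv (airy_fps e)) = fps_X * airy_fps e"
proof (rule fps_ext)
  fix n
  show "fps_nth (fps_deriv (fps_deriv (airy_fps e))) n = fps_nth (fps_X * airy_fps e) n"
  proof (cases n)
    case 0
    then show ?thesis using assms by (simp add: airy_fps_def)
  next
    case (Suc m)
    show ?thesis
    proof (cases "m mod 3 = e")
      case True
      then obtain k where m: "m = 3 * k + e" by (metis mult_div_mod_eq)
      have "fps_nth (airy_fps e) (m + 3) = fps_nth (airy_fps e) (3 * Suc k + e)"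
        by (simp add: m algebra_simps)
      also have "\<dots> = 3 ^ Suc k * pochhammer (real (Suc e) / 3) (Suc k) / fact (3 * Suc k + e)"
        using assms by (intro airy_fps_nth_reindex) simp
      also have "fact (3 * Suc k + e) = real (m + 3) * real (m + 2) * real (m + 1) * fact m"
        by (simp add: m numeral_3_eq_3 algebra_simps)
      also have "3 ^ Suc k * pochhammer (real (Suc e) / 3) (Suc k) = real (m + 1) * (3 ^ k * pochhammer (real (Suc e) / 3) k)"
        by (simp add: pochhammer_Suc m field_simps)
      finally have "fps_nth (airy_fps e) (m + 3) = 3 ^ k * pochhammer (real (Suc e) / 3) k / fact m / (real (m + 2) * real (m + 3))"
        by simp
      also have "3 ^ k * pochhammer (real (Suc e) / 3) k / fact m = fps_nth (airy_fps e) m"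
        using assms by (simp only: m airy_fps_nth_reindex)
      finally have "fps_nth (airy_fps e) (m + 3) * (real (m + 2) * real (m + 3)) = fps_nth (airy_fps e) m"
        by simp
      then show ?thesis by (simp add: Suc numeral_3_eq_3 algebra_simps)
    next
      case False
      then have "(m + 3) mod 3 \<noteq> e" by simp
      then have "fps_nth (airy_fps e) (m + 3) = 0" by (simp add: airy_fps_def)
      moreover have "m + 3 = Suc (Suc (Suc m))" by simp
      moreover have "fps_nth (airy_fps e) m = 0" using False by (simp add: airy_fps_def)
      ultimately show ?thesis by (simp add: Suc)
    qed
  qed
qed

text \<open>The ratio test runs along the indices \<open>3 * k + e\<close> only, because the other
  coefficients vanish. The ratio is read off the Airy equation and falls below 1/2 once
  \<open>n\<close> exceeds \<open>2 * \<bar>x\<bar> ^ 3\<close>.\<close>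

lemma airy_fps_summable_aux:
  fixes x :: real
  assumes "e < 2"
  shows "summable (\<lambda>k. fps_nth (airy_fps e) (3 * k + e) * x ^ (3 * k + e))"
proof -
  obtain N :: nat where N: "2 * \<bar>x\<bar> ^ 3 \<le> real N" using real_arch_simple by blast
  show ?thesis
  proof (rule summable_ratio_test[of "1/2" N])
    fix n :: nat assume n: "N \<le> n"
    let ?a = "\<lambda>k. fps_nth (airy_fps e) (3 * k + e)"
    have "fps_nth (fps_deriv (fps_deriv (airy_fps e))) (Suc (3 * n + e)) = ?a n"
      unfolding airy_fps_ode[OF assms] by simp
    then have rec: "?a (Suc n) * (real (3*n+e+2) * real (3*n+e+3)) = ?a n"
      by (simp add: algebra_simps numeral_3_eq_3)
    have le: "\<bar>x\<bar>^3 \<le> 1/2 * (real (3*n+e+2) * real (3*n+e+3))"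
    proof -
      have "2 * \<bar>x\<bar>^3 \<le> real n" using N n by simp
      also have "\<dots> \<le> real (3*n+e+2) * 1" by simp
      also have "\<dots> \<le> real (3*n+e+2) * real (3*n+e+3)" by (intro mult_left_mono) auto
      finally show ?thesis by simp
    qed
    have p: "x ^ (3 * Suc n + e) = x ^ (3 * n + e) * x ^ 3"
      by (simp flip: power_add add: algebra_simps)
    from le have "\<bar>?a (Suc n)\<bar> * \<bar>x\<bar> ^ (3*n+e) * \<bar>x\<bar>^3 \<le> \<bar>?a (Suc n)\<bar> * \<bar>x\<bar> ^ (3*n+e) * (1/2 * (real (3*n+e+2) * real (3*n+e+3)))"
      by (intro mult_left_mono) auto
    also have "\<dots> = 1/2 * \<bar>?a (Suc n) * (real (3*n+e+2) * real (3*n+e+3))\<bar> * \<bar>x\<bar> ^ (3*n+e)"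
      by (simp add: abs_mult)
    finally show "norm (?a (Suc n) * x ^ (3 * Suc n + e)) \<le> 1/2 * norm (?a n * x ^ (3 * n + e))"
      unfolding rec p by (simp only: real_norm_def abs_mult power_abs mult_ac)
  qed simp
qed

lemma airy_fps_reindex:
  assumes "e < 2"
  shows "strict_mono (\<lambda>k. 3 * k + e :: nat)"
    and "n \<notin> range (\<lambda>k. 3 * k + e) \<Longrightarrow> fps_nth (airy_fps e) n * x ^ n = 0"
proof -
  show "strict_mono (\<lambda>k. 3 * k + e :: nat)" by (auto simp: strict_mono_def)
  assume n: "n \<notin> range (\<lambda>k. 3 * k + e)"
  have "n mod 3 \<noteq> e"
  proof
    assume "n mod 3 = e"
    then have "n = 3 * (n div 3) + e" by auto
    then show False using n by blast
  qed
  then show "fps_nth (airy_fps e) n * x ^ n = 0" by (simp add: airy_fps_def)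
qed

lemma fps_conv_radius_airy:
  assumes "e < 2" shows "fps_conv_radius (airy_fps e) = \<infinity>"
  unfolding fps_conv_radius_def
proof (rule conv_radius_inftyI'')
  fix x :: real
  show "summable (\<lambda>n. fps_nth (airy_fps e) n * x ^ n)"
    using airy_fps_summable_aux[OF assms, of x]
      summable_mono_reindex[of "\<lambda>k. 3 * k + e" "\<lambda>n. fps_nth (airy_fps e) n * x ^ n", OF airy_fps_reindex[OF assms]]
    by simp
qed

lemma eval_airy_fps_aux:
  assumes "e < 2"
  shows "eval_fps (airy_fps e) x = (\<Sum>k. 3 ^ k * pochhammer (real (Suc e) / 3) k / fact (3 * k + e) * x ^ (3 * k + e))"
proof -
  have "(\<Sum>k. fps_nth (airy_fps e) (3 * k + e) * x ^ (3 * k + e)) = eval_fps (airy_fps e) x"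
    unfolding eval_fps_def
    by (rule suminf_mono_reindex[of "\<lambda>k. 3 * k + e" "\<lambda>n. fps_nth (airy_fps e) n * x ^ n", OF airy_fps_reindex[OF assms]])
  then show ?thesis using assms by (simp add: airy_fps_nth_reindex)
qed

lemma eval_airy_fps: "eval_fps (airy_fps 0) = airy_f" "eval_fps (airy_fps 1) = airy_g"
  using eval_airy_fps_aux[of 0] eval_airy_fps_aux[of 1]
  by (auto simp: fun_eq_iff airy_f_def airy_g_def)

section \<open>The power series of Ai^2 + Bi^2\<close>

text \<open>This is the symmetric square of the Airy equation: the second derivative of A B is 2 x A
  B + 2 A' B', and one more differentiation turns A' B' back into x times the derivative of A
  B.\<close>

lemma fps_airy_product_ode:
  fixes A B :: "real fps"
  assumes "fps_deriv (fps_deriv A) = fps_X * A" "fps_deriv (fps_deriv B) = fps_X * B"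
  shows "fps_deriv (fps_deriv (fps_deriv (A * B))) = 2 * (A * B) + 4 * (fps_X * fps_deriv (A * B))"
  using assms by (simp add: algebra_simps)

text \<open>Ai^2 + Bi^2 expanded in f^2, f g and g^2; each 4 arises as 1 + 3, or as -2 + 6 for the
  mixed term.\<close>

definition airy_modulus_fps :: "real fps" where
  "airy_modulus_fps = fps_const (4 * airy_c1\<^sup>2) * (airy_fps 0 * airy_fps 0)
     + fps_const (4 * airy_c1 * airy_c2) * (airy_fps 0 * airy_fps 1)
     + fps_const (4 * airy_c2\<^sup>2) * (airy_fps 1 * airy_fps 1)"

lemma fps_conv_radius_add_infinity: "fps_conv_radius f = \<infinity> \<Longrightarrow> fps_conv_radius g = \<infinity> \<Longrightarrow> fps_conv_radius (f + g) = \<infinity>"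
  for f g :: "real fps"
  using fps_conv_radius_add[of f g] by simp

lemma fps_conv_radius_mult_infinity: "fps_conv_radius f = \<infinity> \<Longrightarrow> fps_conv_radius g = \<infinity> \<Longrightarrow> fps_conv_radius (f * g) = \<infinity>"
  for f g :: "real fps"
  using fps_conv_radius_mult[of f g] by simp

lemma fps_conv_radius_airy_modulus: "fps_conv_radius airy_modulus_fps = \<infinity>"
  unfolding airy_modulus_fps_def
  by (intro fps_conv_radius_add_infinity fps_conv_radius_mult_infinity fps_conv_radius_airy) auto

lemma eval_airy_modulus_fps: "eval_fps airy_modulus_fps x = (Airy_Ai x)\<^sup>2 + (Airy_Bi x)\<^sup>2"
proof -
  note c = fps_conv_radius_mult_infinity fps_conv_radius_add_infinity fps_conv_radius_airy
  have "eval_fps airy_modulus_fps x = 4 * airy_c1\<^sup>2 * (airy_f x * airy_f x) + 4 * airy_c1 * airy_c2 * (airy_f x * airy_g x)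
     + 4 * airy_c2\<^sup>2 * (airy_g x * airy_g x)"
    unfolding airy_modulus_fps_def eval_airy_fps[symmetric]
    by (simp add: eval_fps_add eval_fps_mult c)
  also have "\<dots> = (airy_c1 * airy_f x - airy_c2 * airy_g x)\<^sup>2 + (sqrt 3)\<^sup>2 * (airy_c1 * airy_f x + airy_c2 * airy_g x)\<^sup>2"
    by (simp add: power2_eq_square algebra_simps)
  finally show ?thesis by (simp add: Airy_Ai_def Airy_Bi_def power_mult_distrib)
qed

lemma airy_modulus_fps_ode:
  "fps_deriv (fps_deriv (fps_deriv airy_modulus_fps)) = 2 * airy_modulus_fps + 4 * (fps_X * fps_deriv airy_modulus_fps)"
proof -
  have *: "fps_deriv (fps_deriv (fps_deriv (fps_const c * P))) = 2 * (fps_const c * P) + 4 * (fps_X * fps_deriv (fps_const c * P))"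
    if "fps_deriv (fps_deriv (fps_deriv P)) = 2 * P + 4 * (fps_X * fps_deriv P)" for c and P :: "real fps"
    using that by (simp add: algebra_simps)
  have add: "fps_deriv (fps_deriv (fps_deriv (P + Q))) = 2 * (P + Q) + 4 * (fps_X * fps_deriv (P + Q))"
    if "fps_deriv (fps_deriv (fps_deriv P)) = 2 * P + 4 * (fps_X * fps_deriv P)"
       "fps_deriv (fps_deriv (fps_deriv Q)) = 2 * Q + 4 * (fps_X * fps_deriv Q)" for P Q :: "real fps"
    using that by (simp add: algebra_simps)
  show ?thesis unfolding airy_modulus_fps_def
    by (intro add * fps_airy_product_ode airy_fps_ode) auto
qed

text \<open>The factorial turns coefficients into derivatives at 0, which are to be matched with
  moments of the Laplace kernel. There a step of three indices is one application of the functional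
  equation of Gamma.\<close>

lemma airy_modulus_fps_rec:
  "fact (n + 3) * fps_nth airy_modulus_fps (n + 3) = (4 * real n + 2) * (fact n * fps_nth airy_modulus_fps n)"
proof -
  have "fps_nth (fps_deriv (fps_deriv (fps_deriv airy_modulus_fps))) n
    = 2 * fps_nth airy_modulus_fps n + 4 * (real n * fps_nth airy_modulus_fps n)"
    unfolding airy_modulus_fps_ode by (cases n) simp_all
  then have "real (n+1) * (real (n+2) * (real (n+3) * fps_nth airy_modulus_fps (n + 3))) = (4 * real n + 2) * fps_nth airy_modulus_fps n"
    by (simp add: numeral_3_eq_3 algebra_simps)
  then have "fact n * (real (n+1) * (real (n+2) * (real (n+3) * fps_nth airy_modulus_fps (n + 3)))) = (4 * real n + 2) * (fact n * fps_nth airy_modulus_fps n)"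
    by simp
  moreover have "fact (n+3) = fact n * (real (n+1) * (real (n+2) * real (n+3)))"
    by (simp add: numeral_3_eq_3 algebra_simps)
  ultimately show ?thesis by (simp only: mult.assoc)
qed

lemma airy_modulus_fps_initial:
  "fps_nth airy_modulus_fps 0 = 4 * airy_c1\<^sup>2" "fps_nth airy_modulus_fps 1 = 4 * airy_c1 * airy_c2"
  "fps_nth airy_modulus_fps 2 = 4 * airy_c2\<^sup>2"
  by (simp_all add: airy_modulus_fps_def fps_mult_nth airy_fps_def numeral_2_eq_2)

text \<open>The Airy equation has no first-order term, so the formal derivative of the Wronskian
  vanishes and only the constant coefficient is left.\<close>

lemma airy_wronskian:
  "airy_fps 0 * fps_deriv (airy_fps 1) - fps_deriv (airy_fps 0) * airy_fps 1 = 1" (is "?W = 1")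
proof -
  have "fps_deriv ?W = 0"
    using airy_fps_ode[of 0] airy_fps_ode[of 1] by (simp add: algebra_simps)
  then have "?W = fps_const (fps_nth ?W 0)" by (simp only: fps_deriv_eq_0_iff)
  also have "fps_nth ?W 0 = 1" by (simp add: airy_fps_def)
  finally show ?thesis by simp
qed

section \<open>The Laplace representation of the Airy modulus\<close>

text \<open>Substitution of \<open>c * s ^ m\<close> in Euler's integral. The case
  \<open>m = 3\<close> yields the moments of the kernel, the case \<open>m = 1\<close> the Laplace
  transforms of powers.\<close>

lemma Gamma_moment_integral:
  fixes a c :: real
  assumes a: "0 < a" and c: "0 < c" and m: "0 < m"
  shows "has_bochner_integral lborel (\<lambda>s. indicator {0<..} s * (s powr (a - 1) * exp (- c * s ^ m)))
     (Gamma (a / m) / (m * c powr (a / m)))"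
proof -
  define b where "b = a / m"
  have b: "0 < b" using a m by (simp add: b_def)
  define f where "f = (\<lambda>u::real. u powr (b - 1) * exp (- u))"
  define g where "g = (\<lambda>s::real. c * s ^ m)"
  define g' where "g' = (\<lambda>s::real. c * (m * s ^ (m - 1)))"
  have "(f has_integral Gamma b) {0..}"
    using Gamma_integral_real[OF b] by (simp add: f_def exp_minus divide_inverse)
  \<comment> \<open>Removing the origin leaves the open half-line, which \<open>g\<close> maps
    bijectively and differentiably onto itself.\<close>
  then have "((\<lambda>x. if x \<in> {0<..} then f x else 0) has_integral Gamma b) {0..}"
    by (rule has_integral_spike[of "{0}", rotated 2]) auto
  then have hi: "(f has_integral Gamma b) {0<..}"
    by (subst (asm) has_integral_restrict) auto
  have "f absolutely_integrable_on {0<..}"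
    by (rule nonnegative_absolutely_integrable_1) (use hi in \<open>auto simp: f_def integrable_on_def\<close>)
  moreover have im: "g ` {0<..} = {0<..}"
  proof
    show "g ` {0<..} \<subseteq> {0<..}" using c by (auto simp: g_def)
    show "{0<..} \<subseteq> g ` {0<..}"
    proof
      fix u :: real assume u: "u \<in> {0<..}"
      have "u = g (root m (u / c))" using u c m by (simp add: g_def)
      moreover have "root m (u / c) \<in> {0<..}" using u c m by simp
      ultimately show "u \<in> g ` {0<..}" by blast
    qed
  qed
  moreover have "(\<lambda>x. \<bar>g' x\<bar> * f (g x)) absolutely_integrable_on {0<..} \<and>
           integral {0<..} (\<lambda>x. \<bar>g' x\<bar> * f (g x)) = Gamma b
     \<longleftrightarrow> f absolutely_integrable_on (g ` {0<..}) \<and> integral (g ` {0<..}) f = Gamma b"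
  proof (rule has_absolute_integral_change_of_variables_1')
    show "inj_on g {0<..}" using c m by (auto simp: inj_on_def g_def intro: power_eq_imp_eq_base)
    fix x :: real
    show "(g has_field_derivative g' x) (at x within {0<..})"
      unfolding g_def g'_def by (auto intro!: derivative_eq_intros)
  qed simp
  ultimately have *: "(\<lambda>x. \<bar>g' x\<bar> * f (g x)) absolutely_integrable_on {0<..}"
    "integral {0<..} (\<lambda>x. \<bar>g' x\<bar> * f (g x)) = Gamma b"
    using hi by (auto simp: integral_unique)
  define h where "h = (\<lambda>s::real. s powr (a - 1) * exp (- c * s ^ m))"
  have gh: "\<bar>g' x\<bar> * f (g x) = (m * c powr b) * h x" if x: "x \<in> {0<..}" for x
  proof -
    have x: "0 < x" using x by simp
    have 1: "f (g x) = c powr (b - 1) * x powr (m * (b - 1)) * exp (- c * x ^ m)"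
      using x c by (simp add: f_def g_def powr_mult powr_powr flip: powr_realpow)
    have 2: "\<bar>g' x\<bar> = c * m * x powr (m - 1)"
      using x c m by (simp add: g'_def abs_mult powr_realpow of_nat_diff flip: powr_realpow)
    have 3: "x powr (m - 1) * x powr (m * (b - 1)) = x powr (a - 1)"
      using m by (simp add: b_def algebra_simps of_nat_diff flip: powr_add)
    have 4: "c * c powr (b - 1) = c powr b" using c by (simp add: powr_diff)
    have "\<bar>g' x\<bar> * f (g x) = m * (c * c powr (b - 1)) * (x powr (m - 1) * x powr (m * (b - 1))) * exp (- c * x ^ m)"
      unfolding 1 2 by (simp only: mult_ac)
    then show ?thesis unfolding 3 4 h_def by (simp only: mult_ac)
  qed
  have mc: "0 < m * c powr b" using m c by simp
  have "(\<lambda>x. (m * c powr b) * h x) absolutely_integrable_on {0<..}"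
    using *(1) gh by (subst absolutely_integrable_spike_eq[where S="{}", symmetric]) auto
  then have "(\<lambda>x. inverse (m * c powr b) * ((m * c powr b) * h x)) absolutely_integrable_on {0<..}"
    by (rule set_integrable_mult_right)
  moreover have "(\<lambda>x. inverse (m * c powr b) * ((m * c powr b) * h x)) = h"
    using m c by (simp add: fun_eq_iff field_simps)
  ultimately have h1: "h absolutely_integrable_on {0<..}" by simp
  have "integral {0<..} (\<lambda>x. (m * c powr b) * h x) = Gamma b"
    using *(2) gh by (metis (no_types, lifting) integral_cong)
  then have h2: "integral {0<..} h = Gamma b / (m * c powr b)"
    using m c by (simp add: field_simps)
  \<comment> \<open>Absolute integrability refers to the completed measure; Borel measurability
    brings it down to \<open>lborel\<close>.\<close>
  have meas: "(\<lambda>s. indicator {0<..} s *\<^sub>R h s) \<in> borel_measurable lborel"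
    unfolding h_def by measurable
  have int: "set_integrable lborel {0<..} h"
    using h1 meas unfolding set_integrable_def by (simp add: integrable_completion)
  have "set_lebesgue_integral lborel {0<..} h = Gamma b / (m * c powr b)"
    using set_borel_integral_eq_integral(2)[OF int] h2 by simp
  with int show ?thesis
    unfolding has_bochner_integral_iff set_integrable_def set_lebesgue_integral_def h_def b_def by simp
qed

lemma Gamma_legendre_duplication_real:
  fixes x :: real
  assumes "0 < x"
  shows "Gamma x * Gamma (x + 1/2) = 2 powr (1 - 2 * x) * sqrt pi * Gamma (2 * x)"
proof -
  have "complex_of_real x \<notin> \<int>\<^sub>\<le>\<^sub>0" "complex_of_real x + 1/2 \<notin> \<int>\<^sub>\<le>\<^sub>0"
    using assms by (auto elim!: nonpos_Ints_cases simp: complex_eq_iff)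
  from Gamma_legendre_duplication[OF this]
  have "complex_of_real (Gamma x * Gamma (x + 1/2)) = of_real (2 powr (1 - 2 * x) * sqrt pi * Gamma (2 * x))"
    by (simp add: Gamma_complex_of_real[symmetric] exp_of_real[symmetric] powr_def)
  then show ?thesis by (simp only: of_real_eq_iff)
qed

lemma Gamma_third_reflection: "Gamma (1/3) * Gamma (2/3 :: real) = 2 * pi / sqrt 3"
proof -
  have "complex_of_real (Gamma (1/3) * Gamma (2/3)) = of_real (pi / sin (pi * (1/3)))"
    using Gamma_reflection_complex[of "1/3"]
    by (simp add: Gamma_complex_of_real[symmetric] sin_of_real[symmetric])
  then have "Gamma (1/3) * Gamma (2/3 :: real) = pi / sin (pi / 3)"
    by (simp only: of_real_eq_iff) simp
  then show ?thesis by (simp add: sin_60)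
qed

text \<open>Both sides satisfy \<open>a (n + 3) = (4 n + 2) a n\<close>; the initial values agree by the reflection
  and duplication formulas for the Gamma function.\<close>

lemma airy_modulus_fps_moment:
  "fact n * fps_nth airy_modulus_fps n * pi powr (3/2) =
     Gamma ((n + 1/2) / 3) / (3 * (1/12) powr ((n + 1/2) / 3))"
proof (induction n rule: less_induct)
  case (less n)
  define m where "m = (\<lambda>n::nat. Gamma ((n + 1/2) / 3) / (3 * (1/12) powr ((n + 1/2) / 3)))"
  define G where "G = Gamma (2/3 :: real)"
  have G: "0 < G" by (simp add: G_def)
  define H where "H = Gamma (1/3 :: real)"
  have H: "0 < H" by (simp add: H_def)
  have GH: "H * G = 2 * pi / sqrt 3" using Gamma_third_reflection by (simp add: G_def H_def)
  have pi32: "pi powr (3/2) = pi * sqrt pi"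
    by (simp add: powr_half_sqrt[symmetric] powr_mult_base)
  have p12: "(1/12) powr x = 1 / (2 powr (2 * x) * 3 powr x)" for x :: real
  proof -
    have "(12::real) powr x = (2 powr 2 * 3) powr x" by simp
    also have "\<dots> = 2 powr (2 * x) * 3 powr x" by (simp only: powr_mult powr_powr)
    finally show ?thesis by (simp add: powr_divide)
  qed
  have s3: "sqrt 3 = 3 powr (1/2 :: real)" by (simp add: powr_half_sqrt)
  consider "n = 0" | "n = 1" | "n = 2" | k where "n = k + 3"
    by (metis One_nat_def add.commute le_add_diff_inverse less_2_cases not_less_eq_eq numeral_2_eq_2 numeral_3_eq_3 not_less less_antisym)
  then show ?case
  proof cases
    case 1
    \<comment> \<open>Duplication at 1/6 gives \<open>Gamma (1/6)\<close> in terms of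
      \<open>H\<close> and \<open>G\<close>. One more factor \<open>G\<close> brings in
      \<open>H * G\<close>, known by reflection, so that only the \<open>G\<close> from
      \<open>airy_c1\<close> remains.\<close>
    have "Gamma (1/6) * G = 2 powr (2/3) * sqrt pi * H"
      using Gamma_legendre_duplication_real[of "1/6"] by (simp add: G_def H_def)
    then have "Gamma (1/6) * G\<^sup>2 = 2 powr (2/3) * sqrt pi * (H * G)"
      by (simp add: power2_eq_square mult_ac)
    then have "Gamma (1/6) = 2 powr (2/3) * sqrt pi * (2 * pi / sqrt 3) / G\<^sup>2"
      using G unfolding GH by (simp add: eq_divide_eq mult_ac)
    then have "m 0 = 2 powr (2/3) * 2 * 2 powr (1/3) * (pi * sqrt pi) * 3 powr (1/6) / (3 * 3 powr (1/2) * G\<^sup>2)"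
      by (simp add: m_def p12 s3 mult_ac)
    also have "\<dots> = (2 powr (2/3) * 2 powr (1/3) * 2) * (pi * sqrt pi) * (3 powr (1/6) / (3 * 3 powr (1/2)) / G\<^sup>2)"
      by (simp add: mult_ac)
    also have "2 powr (2/3) * 2 powr (1/3) * 2 = (4::real)"
      by (simp flip: powr_add)
    also have "3 powr (1/6) / (3 * 3 powr (1/2)) = (3::real) powr (- 4/3)"
    proof -
      have "(3::real) powr (- 4/3) = 3 powr (1/6 - (1 + 1/2))" by simp
      also have "\<dots> = 3 powr (1/6) / (3 * 3 powr (1/2))" by (simp only: powr_diff powr_add powr_one_gt_zero_iff powr_one)
      finally show ?thesis by simp
    qed
    also have "4 * (pi * sqrt pi) * (3 powr (- 4/3) / G\<^sup>2) = 4 * airy_c1\<^sup>2 * (pi * sqrt pi)"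
    proof -
      have "(3 powr (2/3))\<^sup>2 = (3::real) powr (4/3)" by (simp add: power2_eq_square flip: powr_add)
      then have "airy_c1\<^sup>2 = 3 powr (- 4/3) / G\<^sup>2"
        by (simp add: airy_c1_def G_def power_divide power_mult_distrib powr_minus_divide)
      then show ?thesis by (simp only: mult_ac)
    qed
    finally show ?thesis using 1 by (simp add: airy_modulus_fps_initial pi32 m_def)
  next
    case 2
    \<comment> \<open>Here the Gamma argument is 1/2, and reflection evaluates the product of
      \<open>airy_c1\<close> and \<open>airy_c2\<close>.\<close>
    have "m 1 = 2 * 3 powr (1/2) / 3 * sqrt pi"
      by (simp add: m_def p12 Gamma_one_half_real)
    moreover have "4 * airy_c1 * airy_c2 * (pi * sqrt pi) = 4 / (3 * (H * G)) * (pi * sqrt pi)"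
    proof -
      have "3 powr (1/3) * 3 powr (2/3) = (3::real)" by (simp flip: powr_add)
      then show ?thesis by (simp add: airy_c1_def airy_c2_def G_def H_def mult_ac)
    qed
    moreover have "\<dots> = 2 * sqrt 3 / 3 * sqrt pi" unfolding GH by (simp add: field_simps)
    ultimately have "m 1 = 4 * airy_c1 * airy_c2 * (pi * sqrt pi)" by (simp only: s3)
    then show ?thesis using 2 airy_modulus_fps_initial(2) by (simp add: pi32 m_def)
  next
    case 3
    \<comment> \<open>Duplication at 1/3 now eliminates \<open>G\<close> in favour of the
      \<open>H\<close> from \<open>airy_c2\<close>.\<close>
    have "Gamma (5/6) * H = 2 powr (1/3) * sqrt pi * G"
      using Gamma_legendre_duplication_real[of "1/3"] by (simp add: G_def H_def mult.commute)
    then have "Gamma (5/6) * H\<^sup>2 = 2 powr (1/3) * sqrt pi * (H * G)"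
      by (simp add: power2_eq_square mult_ac)
    then have "Gamma (5/6) = 2 powr (1/3) * sqrt pi * (2 * pi / sqrt 3) / H\<^sup>2"
      using H unfolding GH by (simp add: eq_divide_eq mult_ac)
    then have "m 2 = 2 powr (1/3) * 2 * 2 powr (5/3) * (pi * sqrt pi) * 3 powr (5/6) / (3 * 3 powr (1/2) * H\<^sup>2)"
      by (simp add: m_def p12 s3 mult_ac)
    also have "\<dots> = (2 powr (1/3) * 2 powr (5/3) * 2) * (pi * sqrt pi) * (3 powr (5/6) / (3 * 3 powr (1/2)) / H\<^sup>2)"
      by (simp add: mult_ac)
    also have "2 powr (1/3) * 2 powr (5/3) * 2 = (8::real)"
      by (simp flip: powr_add)
    also have "3 powr (5/6) / (3 * 3 powr (1/2)) = (3::real) powr (- 2/3)"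
    proof -
      have "(3::real) powr (- 2/3) = 3 powr (5/6 - (1 + 1/2))" by simp
      also have "\<dots> = 3 powr (5/6) / (3 * 3 powr (1/2))" by (simp only: powr_diff powr_add powr_one_gt_zero_iff powr_one)
      finally show ?thesis by simp
    qed
    also have "8 * (pi * sqrt pi) * (3 powr (- 2/3) / H\<^sup>2) = 8 * airy_c2\<^sup>2 * (pi * sqrt pi)"
    proof -
      have "(3 powr (1/3))\<^sup>2 = (3::real) powr (2/3)" by (simp add: power2_eq_square flip: powr_add)
      then have "airy_c2\<^sup>2 = 3 powr (- 2/3) / H\<^sup>2"
        by (simp add: airy_c2_def H_def power_divide power_mult_distrib powr_minus_divide)
      then show ?thesis by (simp only: mult_ac)
    qed
    finally show ?thesis using 3 by (simp add: airy_modulus_fps_initial pi32 m_def)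
  next
    case (4 k)
    define x where "x = (k + 1/2) / (3::real)"
    have x: "0 < x" by (simp add: x_def)
    have "Gamma (x + 1) = x * Gamma x"
      using x by (intro Gamma_plus1) (auto elim!: nonpos_Ints_cases)
    \<comment> \<open>Raising the argument by one contributes \<open>x\<close> from Gamma and 12
      from the power; \<open>12 * x\<close> is the factor \<open>4 * k + 2\<close> of the
      recurrence.\<close>
    then have G: "Gamma (x + 1) / (3 * (1/12) powr (x + 1)) = 12 * x * (Gamma x / (3 * (1/12) powr x))"
      by (simp add: powr_add)
    have nx: "(real n + 1/2) / 3 = x + 1" by (simp add: 4 x_def field_simps)
    have kx: "4 * real k + 2 = 12 * x" by (simp add: x_def)
    have "fact n * fps_nth airy_modulus_fps n * pi powr (3/2) = 12 * x * (fact k * fps_nth airy_modulus_fps k * pi powr (3/2))"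
      using airy_modulus_fps_rec[of k] unfolding kx 4 by (simp only: mult.assoc)
    also have "\<dots> = 12 * x * (Gamma x / (3 * (1/12) powr x))"
      using less.IH[of k] 4 by (simp add: x_def)
    finally show ?thesis unfolding nx G .
  qed
qed

section \<open>Termwise integration of the Laplace kernel\<close>

definition airy_kernel :: "real \<Rightarrow> real \<Rightarrow> real" where
  "airy_kernel z s = indicator {0<..} s * (s powr (- 1/2) * exp (z * s - s ^ 3 / 12))"

text \<open>Expanding \<open>exp (z * s)\<close> and integrating term by term produces the moments,
  hence by \<open>airy_modulus_fps_moment\<close> the power series of Ai^2 + Bi^2.\<close>

lemma airy_modulus_integral:
  "has_bochner_integral lborel (airy_kernel z) (pi powr (3/2) * ((Airy_Ai z)\<^sup>2 + (Airy_Bi z)\<^sup>2))"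
proof -
  define k where "k = (\<lambda>n s::real. indicator {0<..} s * (s powr (real n + 1/2 - 1) * exp (- (1/12) * s ^ 3)))" for n :: nat
  define q where "q = fps_nth airy_modulus_fps"
  have k: "has_bochner_integral lborel (k n) (fact n * q n * pi powr (3/2))" for n
    using Gamma_moment_integral[of "real n + 1/2" "1/12" 3]
    unfolding q_def airy_modulus_fps_moment k_def by simp
  have k_nonneg: "0 \<le> k n s" for n s by (simp add: k_def)
  define f where "f = (\<lambda>z n s. z ^ n / fact n * k n s)" for z :: real
  have f: "has_bochner_integral lborel (f z n) (q n * z ^ n * pi powr (3/2))" for z n
    using has_bochner_integral_mult_right[OF k[of n], of "z ^ n / fact n"] by (simp add: f_def mult_ac)
  \<comment> \<open>Norms only replace \<open>z\<close> by its absolute value, so the summability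
    needed for the interchange is convergence of the same everywhere convergent series at that
    point.\<close>
  have norm_f: "norm (f z n s) = f \<bar>z\<bar> n s" for z n s
    using k_nonneg by (simp add: f_def abs_mult power_abs)
  have q_sums: "(\<lambda>n. q n * z ^ n * pi powr (3/2)) sums (((Airy_Ai z)\<^sup>2 + (Airy_Bi z)\<^sup>2) * pi powr (3/2))" for z
    unfolding q_def eval_airy_modulus_fps[symmetric]
    by (intro sums_mult2 sums_eval_fps) (simp add: fps_conv_radius_airy_modulus)
  have f_sums: "(\<lambda>n. f z n s) sums airy_kernel z s" for z s
  proof (cases "0 < s")
    case True
    have i: "indicator {0<..} s = (1::real)" using True by simp
    have "(\<lambda>n. s powr (-1/2) * exp (- (1/12) * s ^ 3) * ((z * s) ^ n /\<^sub>R fact n)) sums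
       (s powr (-1/2) * exp (- (1/12) * s ^ 3) * exp (z * s))"
      by (intro sums_mult exp_converges)
    moreover have "f z n s = s powr (-1/2) * exp (- (1/12) * s ^ 3) * ((z * s) ^ n /\<^sub>R fact n)" for n
    proof -
      have "s powr (real n + 1/2 - 1) = s powr (-1/2 + real n)" by simp
      also have "\<dots> = s powr (-1/2) * s ^ n" using True by (simp only: powr_add powr_realpow)
      finally have p: "s powr (real n + 1/2 - 1) = s powr (-1/2) * s ^ n" .
      show ?thesis
        unfolding f_def k_def p i by (simp only: power_mult_distrib divide_inverse real_scaleR_def mult_1_left mult_ac)
    qed
    moreover have "airy_kernel z s = s powr (-1/2) * exp (- (1/12) * s ^ 3) * exp (z * s)"
    proof -
      have "exp (z * s - s ^ 3 / 12) = exp (- (1/12) * s ^ 3) * exp (z * s)" by (simp flip: exp_add)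
      then show ?thesis unfolding airy_kernel_def i by (simp only: mult_1_left mult.assoc)
    qed
    ultimately show ?thesis by (simp only:)
  qed (simp add: f_def k_def airy_kernel_def)
  have int: "integrable lborel (f z n)" for z n using f by (simp add: has_bochner_integral_iff)
  have summ: "AE s in lborel. summable (\<lambda>n. norm (f z n s))"
    unfolding norm_f using f_sums by (auto simp: sums_iff)
  have summ2: "summable (\<lambda>n. \<integral>s. norm (f z n s) \<partial>lborel)"
    unfolding norm_f using f[THEN has_bochner_integral_integral_eq] q_sums by (simp add: sums_iff)
  have eq: "(\<lambda>s. \<Sum>n. f z n s) = airy_kernel z"
    using f_sums by (simp add: sums_iff fun_eq_iff)
  have "(\<integral>s. airy_kernel z s \<partial>lborel) = (\<Sum>n. integral\<^sup>L lborel (f z n))"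
    using integral_suminf[OF int summ summ2] by (simp add: eq)
  also have "\<dots> = ((Airy_Ai z)\<^sup>2 + (Airy_Bi z)\<^sup>2) * pi powr (3/2)"
    using f[THEN has_bochner_integral_integral_eq] q_sums by (simp add: sums_iff)
  finally show ?thesis
    using integrable_suminf[OF int summ summ2] by (simp add: has_bochner_integral_iff eq)
qed

section \<open>The phase of the reference solution\<close>

text \<open>At \<open>t = F powr (1/3) * (x + E / F)\<close> this is \<open>F powr (1/3)\<close>
  times the squared modulus of \<open>zeta_ref F E x\<close>.\<close>

definition airy_phi :: "real \<Rightarrow> real" where
  "airy_phi t = pi * ((Airy_Ai (- t))\<^sup>2 + (Airy_Bi (- t))\<^sup>2)"

lemma airy_phi_integral: "has_bochner_integral lborel (airy_kernel (- t)) (sqrt pi * airy_phi t)"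
proof -
  have "pi powr (3/2) = sqrt pi * pi" by (simp add: powr_half_sqrt[symmetric] powr_mult_base mult.commute)
  then show ?thesis using airy_modulus_integral[of "- t"] by (simp add: airy_phi_def mult.assoc)
qed

section \<open>Two-sided bounds for the modulus and its increments\<close>

lemma laplace_powr:
  fixes a t :: real
  assumes "0 < a" "0 < t"
  shows "has_bochner_integral lborel (\<lambda>s. indicator {0<..} s * (s powr (a - 1) * exp (- t * s)))
     (Gamma a / t powr a)"
  using Gamma_moment_integral[of a t 1] assms by simp

lemma Gamma_plus1_pos: "0 < x \<Longrightarrow> Gamma (x + 1) = x * Gamma (x::real)"
  by (intro Gamma_plus1) (auto elim!: nonpos_Ints_cases)

text \<open>The factor \<open>1 - s\<^sup>3/12\<close> is a lower bound for \<open>exp (- s\<^sup>3/12)\<close> whose Laplace transform is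
  explicit.\<close>

lemma laplace_powr_cubic_lower:
  fixes a t :: real
  assumes "0 < a" "a \<le> 3/2" "2 \<le> t"
  shows "\<exists>I. has_bochner_integral lborel
     (\<lambda>s. indicator {0<..} s * (s powr (a - 1) * exp (- t * s) * (1 - s ^ 3 / 12))) I
     \<and> Gamma a / t powr a / 2 \<le> I"
proof -
  define f where "f = (\<lambda>b s. indicator {0<..} s * (s powr (b - 1) * exp (- t * s)))" for b :: real
  have f: "has_bochner_integral lborel (f b) (Gamma b / t powr b)" if "0 < b" for b
    unfolding f_def using laplace_powr[OF that] assms by simp
  have "has_bochner_integral lborel (\<lambda>s. f a s - (1/12) * f (a + 3) s) (Gamma a / t powr a - (1/12) * (Gamma (a + 3) / t powr (a + 3)))"
    using assms by (intro has_bochner_integral_diff has_bochner_integral_mult_right f) auto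
  moreover have "f a s - (1/12) * f (a + 3) s = indicator {0<..} s * (s powr (a - 1) * exp (- t * s) * (1 - s ^ 3 / 12))" for s
  proof (cases "0 < s")
    case True
    have "s powr (a + 3 - 1) = s powr (a - 1 + real 3)" by simp
    also have "\<dots> = s powr (a - 1) * s ^ 3" using True by (simp only: powr_add powr_realpow)
    finally show ?thesis unfolding f_def by (simp add: algebra_simps)
  qed (simp add: f_def)
  moreover have "Gamma a / t powr a / 2 \<le> Gamma a / t powr a - (1/12) * (Gamma (a + 3) / t powr (a + 3))"
  proof -
    have "Gamma (a + 3) = (a + 2) * ((a + 1) * (a * Gamma a))"
      using assms Gamma_plus1_pos[of a] Gamma_plus1_pos[of "a + 1"] Gamma_plus1_pos[of "a + 2"] by (simp add: add.assoc)
    moreover have "(a + 2) * ((a + 1) * a) \<le> (7/2) * ((5/2) * (3/2))"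
      using assms by (intro mult_mono) auto
    \<comment> \<open>With \<open>t ^ 3 \<ge> 8\<close> and the prefactor 1/12, the constant 48
      makes the subtracted term at most half of the main one.\<close>
    ultimately have "Gamma (a + 3) \<le> 48 * Gamma a"
      using assms mult_right_mono[of "(a + 2) * ((a + 1) * a)" 48 "Gamma a"] by (simp add: mult.assoc)
    moreover have "t powr (a + 3) = t powr a * t ^ 3"
      using assms by (simp add: powr_add powr_numeral)
    moreover have "8 \<le> t ^ 3" using power_mono[of 2 t 3] assms by simp
    then have "t powr a * 8 \<le> t powr a * t ^ 3" by (intro mult_left_mono) auto
    moreover have "0 < t powr a" using assms by simp
    ultimately have "Gamma (a + 3) / t powr (a + 3) \<le> 48 * Gamma a / (t powr a * 8)"
      using assms by (intro frac_le) auto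
    then show ?thesis by simp
  qed
  ultimately show ?thesis by (intro exI[of _ "Gamma a / t powr a - (1/12) * (Gamma (a + 3) / t powr (a + 3))"]) simp
qed

lemma has_bochner_integral_mono:
  fixes f g :: "'a \<Rightarrow> real"
  assumes "has_bochner_integral M f x" "has_bochner_integral M g y" "\<And>s. f s \<le> g s"
  shows "x \<le> y"
  using assms integral_mono[of M f g] by (auto simp: has_bochner_integral_iff)

text \<open>Bounding the cubic exponential factor by 1 leaves the Laplace transform of
  \<open>s powr (- 1/2)\<close>.\<close>

lemma airy_phi_upper:
  assumes "0 < t" shows "airy_phi t \<le> t powr (- 1/2)"
proof -
  have "sqrt pi * airy_phi t \<le> Gamma (1/2) / t powr (1/2)"
  proof (rule has_bochner_integral_mono[OF airy_phi_integral laplace_powr])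
    fix s
    show "airy_kernel (- t) s \<le> indicator {0<..} s * (s powr (1/2 - 1) * exp (- t * s))"
      unfolding airy_kernel_def by (cases "0 < s") (auto intro!: mult_left_mono)
  qed (use assms in auto)
  also have "\<dots> = sqrt pi * t powr (- 1/2)"
    by (simp add: Gamma_one_half_real powr_minus_divide)
  finally show ?thesis by simp
qed

lemma exp_neg_cubic_ge: "1 - s ^ 3 / 12 \<le> exp (- (s ^ 3 / 12))" for s :: real
  using exp_ge_add_one_self[of "- (s ^ 3 / 12)"] by simp

lemma airy_phi_lower:
  assumes "2 \<le> t" shows "t powr (- 1/2) / 2 \<le> airy_phi t"
proof -
  obtain I where I: "has_bochner_integral lborel
     (\<lambda>s. indicator {0<..} s * (s powr (1/2 - 1) * exp (- t * s) * (1 - s ^ 3 / 12))) I"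
     "Gamma (1/2) / t powr (1/2) / 2 \<le> I"
    using laplace_powr_cubic_lower[of "1/2" t] assms by auto
  have "I \<le> sqrt pi * airy_phi t"
  proof (rule has_bochner_integral_mono[OF I(1) airy_phi_integral])
    fix s
    have "exp (- t * s - s ^ 3 / 12) = exp (- t * s) * exp (- (s ^ 3 / 12))" by (simp flip: exp_add)
    then show "indicator {0<..} s * (s powr (1/2 - 1) * exp (- t * s) * (1 - s ^ 3 / 12)) \<le> airy_kernel (- t) s"
      unfolding airy_kernel_def
      by (cases "0 < s") (auto intro!: mult_left_mono simp: exp_neg_cubic_ge mult.assoc)
  qed
  moreover have "Gamma (1/2) / t powr (1/2) / 2 = sqrt pi * (t powr (- 1/2) / 2)"
    by (simp add: Gamma_one_half_real powr_minus_divide)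
  ultimately have "sqrt pi * (t powr (- 1/2) / 2) \<le> sqrt pi * airy_phi t" using I(2) by linarith
  then show ?thesis by simp
qed

text \<open>Both bounds are \<open>1 + y \<le> exp y\<close>: with \<open>y = (u - t) * s\<close>
  after factoring out \<open>exp (- u * s)\<close>, and with the opposite sign after factoring out
  \<open>exp (- t * s)\<close>.\<close>

lemma exp_neg_diff_bounds:
  fixes s t u :: real
  assumes "0 \<le> s" "t \<le> u"
  shows "(u - t) * s * exp (- u * s) \<le> exp (- t * s) - exp (- u * s)"
    and "exp (- t * s) - exp (- u * s) \<le> (u - t) * s * exp (- t * s)"
proof -
  have e: "exp (- t * s) = exp (- u * s) * exp ((u - t) * s)" "exp (- u * s) = exp (- t * s) * exp (- ((u - t) * s))"
    by (simp_all flip: exp_add add: algebra_simps)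
  have "exp (- u * s) * (1 + (u - t) * s) \<le> exp (- u * s) * exp ((u - t) * s)"
    by (intro mult_left_mono exp_ge_add_one_self) auto
  then show "(u - t) * s * exp (- u * s) \<le> exp (- t * s) - exp (- u * s)"
    unfolding e(1)[symmetric] by (simp add: algebra_simps)
  have "exp (- t * s) * (1 + - ((u - t) * s)) \<le> exp (- t * s) * exp (- ((u - t) * s))"
    by (intro mult_left_mono exp_ge_add_one_self) auto
  then show "exp (- t * s) - exp (- u * s) \<le> (u - t) * s * exp (- t * s)"
    unfolding e(2)[symmetric] by (simp add: algebra_simps)
qed

lemma Gamma_three_halves: "Gamma (3/2 :: real) = sqrt pi / 2"
  using Gamma_plus1_pos[of "1/2"] by (simp add: Gamma_one_half_real)

lemma airy_kernel_diff:
  "airy_kernel (- t) s - airy_kernel (- u) s =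
     indicator {0<..} s * (s powr (- 1/2) * exp (- (s ^ 3 / 12)) * (exp (- t * s) - exp (- u * s)))"
proof -
  have e: "exp (- t * s - s ^ 3 / 12) = exp (- (s ^ 3 / 12)) * exp (- t * s)" for t by (simp flip: exp_add)
  show ?thesis unfolding airy_kernel_def e by (simp add: algebra_simps)
qed

lemma powr_half_step: "0 < s \<Longrightarrow> s powr (3/2 - 1) = s powr (- 1/2) * s" for s :: real
  using powr_add[of s "-1/2" 1] by simp

text \<open>The difference of exponentials supplies a factor \<open>(u - t) * s\<close>. It raises
  the power of \<open>s\<close> from -1/2 to 1/2, whose transform decays like the derivative of
  \<open>t powr (- 1/2)\<close>.\<close>

lemma airy_phi_diff_upper:
  assumes "0 < t" "t \<le> u" shows "airy_phi t - airy_phi u \<le> (u - t) * t powr (- 3/2) / 2"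
proof -
  have "sqrt pi * airy_phi t - sqrt pi * airy_phi u \<le> (u - t) * (Gamma (3/2) / t powr (3/2))"
  proof (rule has_bochner_integral_mono[OF has_bochner_integral_diff[OF airy_phi_integral airy_phi_integral]
        has_bochner_integral_mult_right[OF laplace_powr]])
    fix s
    show "airy_kernel (- t) s - airy_kernel (- u) s \<le> (u - t) * (indicator {0<..} s * (s powr (3/2 - 1) * exp (- t * s)))"
    proof (cases "0 < s")
      case True
      have "s powr (- 1/2) * exp (- (s ^ 3 / 12)) * (exp (- t * s) - exp (- u * s))
         \<le> s powr (- 1/2) * 1 * ((u - t) * s * exp (- t * s))"
        using True assms exp_neg_diff_bounds[of s t u]
        by (intro mult_mono) (auto intro: mult_right_mono)
      then show ?thesis unfolding airy_kernel_diff powr_half_step[OF True] using True by (simp add: mult_ac)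
    qed (simp add: airy_kernel_def)
  qed (use assms in auto)
  also have "\<dots> = sqrt pi * ((u - t) * t powr (- 3/2) / 2)"
    by (simp add: Gamma_three_halves powr_minus_divide mult_ac)
  finally show ?thesis by (simp flip: right_diff_distrib)
qed

text \<open>Here the exponential is taken at the larger point \<open>u\<close>, where the explicit
  transform of the cubic minorant applies; hence the size condition on \<open>u\<close>.\<close>

lemma airy_phi_diff_lower:
  assumes "0 < t" "t \<le> u" "2 \<le> u" shows "(u - t) * u powr (- 3/2) / 4 \<le> airy_phi t - airy_phi u"
proof -
  obtain I where I: "has_bochner_integral lborel
     (\<lambda>s. indicator {0<..} s * (s powr (3/2 - 1) * exp (- u * s) * (1 - s ^ 3 / 12))) I"
     "Gamma (3/2) / u powr (3/2) / 2 \<le> I"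
    using laplace_powr_cubic_lower[of "3/2" u] assms by auto
  have "(u - t) * I \<le> sqrt pi * airy_phi t - sqrt pi * airy_phi u"
  proof (rule has_bochner_integral_mono[OF has_bochner_integral_mult_right[OF I(1)] has_bochner_integral_diff[OF airy_phi_integral airy_phi_integral]])
    fix s
    show "(u - t) * (indicator {0<..} s * (s powr (3/2 - 1) * exp (- u * s) * (1 - s ^ 3 / 12))) \<le> airy_kernel (- t) s - airy_kernel (- u) s"
    proof (cases "0 < s")
      case True
      have "s powr (- 1/2) * ((1 - s ^ 3 / 12) * ((u - t) * s * exp (- u * s)))
         \<le> s powr (- 1/2) * (exp (- (s ^ 3 / 12)) * ((u - t) * s * exp (- u * s)))"
        using True assms by (intro mult_left_mono mult_right_mono exp_neg_cubic_ge) auto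
      also have "\<dots> \<le> s powr (- 1/2) * (exp (- (s ^ 3 / 12)) * (exp (- t * s) - exp (- u * s)))"
        using True assms exp_neg_diff_bounds[of s t u] by (intro mult_left_mono) auto
      finally show ?thesis unfolding airy_kernel_diff powr_half_step[OF True] using True by (simp add: mult_ac)
    qed (simp add: airy_kernel_def)
  qed
  moreover have "(u - t) * (Gamma (3/2) / u powr (3/2) / 2) \<le> (u - t) * I"
    using I(2) assms by (intro mult_left_mono) auto
  moreover have "(u - t) * (Gamma (3/2) / u powr (3/2) / 2) = sqrt pi * ((u - t) * u powr (- 3/2) / 4)"
    by (simp add: Gamma_three_halves powr_minus_divide mult_ac)
  ultimately have "sqrt pi * ((u - t) * u powr (- 3/2) / 4) \<le> sqrt pi * (airy_phi t - airy_phi u)"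
    by (simp only: right_diff_distrib)
  then show ?thesis by simp
qed

section \<open>Continuous phases of nonvanishing curves\<close>

text \<open>The difference of two phases is continuous with values in the multiples of
  \<open>2 * pi\<close>, hence constant; the normalisation at 0 keeps it below one period.\<close>

lemma continuous_phase_unique:
  fixes g1 g2 :: "real \<Rightarrow> real"
  assumes cont: "continuous_on UNIV g1" "continuous_on UNIV g2"
    and eq: "\<And>x. cis (g1 x) = cis (g2 x)"
    and b: "- pi < g1 0" "g1 0 \<le> pi" "- pi < g2 0" "g2 0 \<le> pi"
  shows "g1 = g2"
proof -
  define d where "d = (\<lambda>x. g1 x - g2 x)"
  have "\<exists>n::int. d x = 2 * pi * n" for x
  proof -
    have "cis (d x) = 1" unfolding d_def using eq[of x] by (simp flip: cis_divide)
    then have "cos (d x) = 1" by (simp add: complex_eq_iff)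
    then show ?thesis by (auto simp: cos_one_2pi_int mult_ac)
  qed
  then obtain n :: "real \<Rightarrow> int" where n: "\<And>x. d x = 2 * pi * n x" by metis
  have "d constant_on UNIV"
  proof (rule continuous_discrete_range_constant)
    show "continuous_on UNIV d" unfolding d_def by (intro continuous_intros cont)
    fix x :: real
    show "\<exists>e>0. \<forall>y. y \<in> UNIV \<and> d y \<noteq> d x \<longrightarrow> e \<le> norm (d y - d x)"
    proof (intro exI[of _ "2 * pi"] conjI allI impI)
      fix y assume "y \<in> UNIV \<and> d y \<noteq> d x"
      then have "n y \<noteq> n x" using n by metis
      then have "1 \<le> \<bar>real_of_int (n y - n x)\<bar>" by linarith
      then have "2 * pi * 1 \<le> 2 * pi * \<bar>real_of_int (n y - n x)\<bar>" by (intro mult_left_mono) auto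
      also have "\<dots> = norm (d y - d x)" by (simp add: n abs_mult flip: right_diff_distrib)
      finally show "2 * pi \<le> norm (d y - d x)" by simp
    qed simp
  qed simp
  moreover have "d 0 = 0"
  proof -
    have "\<bar>d 0\<bar> < 2 * pi" using b by (simp add: d_def)
    then have "2 * pi * \<bar>real_of_int (n 0)\<bar> < 2 * pi * 1" by (simp add: n abs_mult)
    then have "\<bar>real_of_int (n 0)\<bar> < 1" by (rule mult_left_less_imp_less) simp
    then show ?thesis by (simp add: n)
  qed
  ultimately have "d x = 0" for x by (metis UNIV_I constant_on_def)
  then show ?thesis by (auto simp: d_def)
qed

text \<open>An antiderivative \<open>L\<close> of \<open>Z' / Z\<close> makes the derivative of
  \<open>Z * exp (- L)\<close> vanish, so after fixing the constant it is a logarithm of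
  \<open>Z\<close>; its imaginary part is the phase.\<close>

lemma continuous_phase_exists:
  fixes Z Z' :: "real \<Rightarrow> complex"
  assumes der: "\<And>x. (Z has_vector_derivative Z' x) (at x)"
    and cont: "continuous_on UNIV Z'" and nz: "\<And>x. Z x \<noteq> 0"
  obtains g where "\<And>x. Z x = of_real (cmod (Z x)) * cis (g x)" "- pi < g 0" "g 0 \<le> pi"
    "\<And>x. (g has_real_derivative Im (Z' x / Z x)) (at x)"
proof -
  have contZ: "continuous_on UNIV Z"
    using der by (auto simp: continuous_on_eq_continuous_at intro: has_vector_derivative_continuous)
  have "\<exists>L. \<forall>x::real. - \<infinity> < ereal x \<longrightarrow> ereal x < \<infinity> \<longrightarrow> (L has_vector_derivative Z' x / Z x) (at x)"
  proof (rule einterval_antiderivative)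
    fix x :: real
    show "isCont (\<lambda>x. Z' x / Z x) x"
      using cont contZ nz by (auto simp: continuous_on_eq_continuous_at intro!: continuous_intros)
  qed simp
  then obtain L0 where L0: "\<And>x. (L0 has_vector_derivative Z' x / Z x) (at x)" by auto
  \<comment> \<open>The constant makes \<open>L 0\<close> the principal logarithm of
    \<open>Z 0\<close>, whose imaginary part has the required range.\<close>
  define L where "L = (\<lambda>x. L0 x + (Ln (Z 0) - L0 0))"
  have L: "(L has_vector_derivative Z' x / Z x) (at x)" for x
    unfolding L_def by (auto intro!: derivative_eq_intros L0)
  have expL: "((\<lambda>x. exp (- L x)) has_vector_derivative - (Z' x / Z x) * exp (- L x)) (at x)" for x
    using field_vector_diff_chain_at[OF has_vector_derivative_minus[OF L[of x]] DERIV_exp]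
    by (simp add: o_def)
  have "((\<lambda>x. Z x * exp (- L x)) has_vector_derivative 0) (at x)" for x
  proof -
    have "Z x * (- (Z' x / Z x) * exp (- L x)) + Z' x * exp (- L x) = 0" using nz[of x] by simp
    then show ?thesis using has_vector_derivative_mult[OF der[of x] expL[of x]] by (simp only:)
  qed
  then obtain c where c: "\<And>x. x \<in> UNIV \<Longrightarrow> Z x * exp (- L x) = c"
    using has_vector_derivative_zero_constant[of UNIV "\<lambda>x. Z x * exp (- L x)"] by auto
  have "Z 0 * exp (- L 0) = 1" using nz[of 0] by (simp add: L_def exp_minus)
  then have ZL: "Z x * exp (- L x) = 1" for x using c[of 0] c[of x] by simp
  have Zexp: "Z x = exp (L x)" for x
    using ZL[of x] by (simp add: exp_minus field_simps)
  show ?thesis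
  proof
    fix x
    show "Z x = of_real (cmod (Z x)) * cis (Im (L x))"
      unfolding Zexp norm_exp_eq_Re by (rule exp_eq_polar)
    show "((\<lambda>x. Im (L x)) has_real_derivative Im (Z' x / Z x)) (at x)"
      using bounded_linear.has_vector_derivative[OF bounded_linear_Im L[of x]]
      by (simp add: has_real_derivative_iff_has_vector_derivative)
  next
    show "- pi < Im (L 0)" "Im (L 0) \<le> pi"
      using mpi_less_Im_Ln[OF nz[of 0]] Im_Ln_le_pi[OF nz[of 0]] by (simp_all add: L_def)
  qed
qed

section \<open>The Wronskian and the derivative of the phase\<close>

definition Airy_Ai' :: "real \<Rightarrow> real" where
  "Airy_Ai' x = airy_c1 * eval_fps (fps_deriv (airy_fps 0)) x - airy_c2 * eval_fps (fps_deriv (airy_fps 1)) x"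

definition Airy_Bi' :: "real \<Rightarrow> real" where
  "Airy_Bi' x = sqrt 3 * (airy_c1 * eval_fps (fps_deriv (airy_fps 0)) x + airy_c2 * eval_fps (fps_deriv (airy_fps 1)) x)"

lemma fps_conv_radius_airy_deriv: "e < 2 \<Longrightarrow> fps_conv_radius (fps_deriv (airy_fps e)) = \<infinity>"
  using fps_conv_radius_deriv[of "airy_fps e"] by (simp add: fps_conv_radius_airy)

lemma Airy_deriv:
  "(Airy_Ai has_real_derivative Airy_Ai' x) (at x)" "(Airy_Bi has_real_derivative Airy_Bi' x) (at x)"
proof -
  have "(eval_fps (airy_fps e) has_real_derivative eval_fps (fps_deriv (airy_fps e)) x) (at x)" if "e < 2" for e
    using that by (intro has_field_derivative_eval_fps) (simp add: fps_conv_radius_airy)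
  from this[of 0] this[of 1]
  have "(airy_f has_real_derivative eval_fps (fps_deriv (airy_fps 0)) x) (at x)"
       "(airy_g has_real_derivative eval_fps (fps_deriv (airy_fps 1)) x) (at x)"
    by (simp_all add: eval_airy_fps[unfolded One_nat_def])
  then show "(Airy_Ai has_real_derivative Airy_Ai' x) (at x)" "(Airy_Bi has_real_derivative Airy_Bi' x) (at x)"
    unfolding Airy_Ai_def[abs_def] Airy_Bi_def[abs_def] Airy_Ai'_def Airy_Bi'_def
    by (auto intro!: derivative_eq_intros)
qed

text \<open>Expansion leaves \<open>2 * sqrt 3 * (airy_c1 * airy_c2)\<close> times the Wronskian of
  the two series, which is 1; the reflection formula at 1/3 evaluates the constant.\<close>

lemma Airy_wronskian: "Airy_Ai x * Airy_Bi' x - Airy_Ai' x * Airy_Bi x = 1 / pi"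
proof -
  note c = fps_conv_radius_airy fps_conv_radius_airy_deriv fps_conv_radius_mult_infinity
  have "eval_fps (airy_fps 0 * fps_deriv (airy_fps 1) - fps_deriv (airy_fps 0) * airy_fps 1) x = 1"
    unfolding airy_wronskian by simp
  then have w: "airy_f x * eval_fps (fps_deriv (airy_fps 1)) x - eval_fps (fps_deriv (airy_fps 0)) x * airy_g x = 1"
    unfolding eval_airy_fps[symmetric] by (simp add: eval_fps_diff eval_fps_mult c)
  have "Airy_Ai x * Airy_Bi' x - Airy_Ai' x * Airy_Bi x = 2 * sqrt 3 * (airy_c1 * airy_c2)
     * (airy_f x * eval_fps (fps_deriv (airy_fps 1)) x - eval_fps (fps_deriv (airy_fps 0)) x * airy_g x)"
    unfolding Airy_Ai_def Airy_Bi_def Airy_Ai'_def Airy_Bi'_def by (simp add: algebra_simps)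
  also have "\<dots> = 2 * sqrt 3 * (airy_c1 * airy_c2)" unfolding w by simp
  also have "airy_c1 * airy_c2 = 1 / (3 * (Gamma (1/3) * Gamma (2/3)))"
  proof -
    have "3 powr (1/3) * 3 powr (2/3) = (3::real)" by (simp flip: powr_add)
    then show ?thesis by (simp add: airy_c1_def airy_c2_def mult_ac)
  qed
  also have "2 * sqrt 3 * \<dots> = 1 / pi"
    unfolding Gamma_third_reflection by (simp add: field_simps)
  finally show ?thesis .
qed

lemma airy_phi_pos: "0 < airy_phi t"
proof -
  have "Airy_Ai (- t) \<noteq> 0 \<or> Airy_Bi (- t) \<noteq> 0" using Airy_wronskian[of "- t"] by auto
  then show ?thesis unfolding airy_phi_def
    by (intro mult_pos_pos) (auto simp: sum_power2_gt_zero_iff)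
qed

lemma continuous_Airy':
  "continuous_on UNIV Airy_Ai'" "continuous_on UNIV Airy_Bi'"
  unfolding Airy_Ai'_def[abs_def] Airy_Bi'_def[abs_def]
  by (auto intro!: continuous_intros simp: fps_conv_radius_airy_deriv)

text \<open>Existence and uniqueness of the normalised phase resolve the definite description. The
  derivative \<open>Im (Z' / Z)\<close> is a Wronskian divided by the squared modulus.\<close>

lemma gamma_phase_deriv:
  assumes F: "0 < F"
  shows "(gamma_phase F E has_real_derivative F powr (1/3) / airy_phi (F powr (1/3) * (x + E / F))) (at x)"
proof -
  define k where "k = F powr (1/3)"
  have k: "0 < k" using F by (simp add: k_def)
  define \<tau> where "\<tau> = (\<lambda>x. - k * (x + E / F))"
  define c where "c = sqrt (pi / k)"
  have c: "0 < c" "c\<^sup>2 = pi / k" using k by (simp_all add: c_def)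
  define Z where "Z = zeta_ref F E"
  have Z: "Z x = Complex (c * Airy_Bi (\<tau> x)) (c * Airy_Ai (\<tau> x))" for x
    by (simp add: Z_def zeta_ref_def c_def \<tau>_def k_def complex_eq_iff)
  define Z' where "Z' = (\<lambda>x. Complex (- (c * k) * Airy_Bi' (\<tau> x)) (- (c * k) * Airy_Ai' (\<tau> x)))"
  have \<tau>: "(\<tau> has_real_derivative - k) (at x)" for x
    unfolding \<tau>_def by (auto intro!: derivative_eq_intros)
  then have "((\<lambda>x. c * Airy_Bi (\<tau> x)) has_real_derivative - (c * k) * Airy_Bi' (\<tau> x)) (at x)"
    "((\<lambda>x. c * Airy_Ai (\<tau> x)) has_real_derivative - (c * k) * Airy_Ai' (\<tau> x)) (at x)" for x
    using DERIV_cmult[OF DERIV_chain2[OF Airy_deriv(1) \<tau>[of x]], of c]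
      DERIV_cmult[OF DERIV_chain2[OF Airy_deriv(2) \<tau>[of x]], of c] by (simp_all add: mult_ac)
  then have der: "(Z has_vector_derivative Z' x) (at x)" for x
    unfolding Z[abs_def] Z'_def
    by (auto simp: has_vector_derivative_complex_iff has_real_derivative_iff_has_vector_derivative)
  have contZ': "continuous_on UNIV Z'"
    unfolding Z'_def Complex_eq \<tau>_def
    by (intro continuous_intros continuous_on_compose2[OF continuous_Airy'(1)] continuous_on_compose2[OF continuous_Airy'(2)]) auto
  have cmodZ: "(cmod (Z x))\<^sup>2 = airy_phi (- \<tau> x) / k" for x
    by (simp add: Z cmod_power2 power_mult_distrib c airy_phi_def add_divide_distrib distrib_left)
  have nz: "Z x \<noteq> 0" for x
    using cmodZ[of x] airy_phi_pos[of "- \<tau> x"] k by (auto simp: field_simps)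
  obtain g where g: "\<And>x. Z x = of_real (cmod (Z x)) * cis (g x)" "- pi < g 0" "g 0 \<le> pi"
    "\<And>x. (g has_real_derivative Im (Z' x / Z x)) (at x)"
    using continuous_phase_exists[OF der contZ' nz] by blast
  have contg: "continuous_on UNIV g"
    using g(4) DERIV_isCont by (auto simp: continuous_on_eq_continuous_at)
  have "gamma_phase F E = g" unfolding gamma_phase_def Z_def[symmetric]
  proof (rule the_equality)
    show "continuous_on UNIV g \<and> (\<forall>x. Z x = of_real (cmod (Z x)) * cis (g x)) \<and> - pi < g 0 \<and> g 0 \<le> pi"
      using g contg by blast
    fix g' assume g': "continuous_on UNIV g' \<and> (\<forall>x. Z x = of_real (cmod (Z x)) * cis (g' x)) \<and> - pi < g' 0 \<and> g' 0 \<le> pi"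
    show "g' = g"
    proof (rule continuous_phase_unique)
      fix x
      have "of_real (cmod (Z x)) * cis (g' x) = of_real (cmod (Z x)) * cis (g x)"
        using g' g(1)[of x] by metis
      then show "cis (g' x) = cis (g x)" using nz[of x] by simp
    qed (use g g' contg in auto)
  qed
  moreover have "Im (Z' x / Z x) = k / airy_phi (- \<tau> x)"
  proof -
    have "Im (Z' x / Z x) = (Im (Z' x) * Re (Z x) - Re (Z' x) * Im (Z x)) / (cmod (Z x))\<^sup>2"
      by (simp add: Im_divide cmod_power2)
    \<comment> \<open>The inner derivative \<open>- k\<close> fixes the sign of the Wronskian, and
      \<open>c\<twosuperior> * k = pi\<close> then makes the numerator 1.\<close>
    also have "Im (Z' x) * Re (Z x) - Re (Z' x) * Im (Z x) = c\<^sup>2 * k * (Airy_Ai (\<tau> x) * Airy_Bi' (\<tau> x) - Airy_Ai' (\<tau> x) * Airy_Bi (\<tau> x))"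
      by (simp add: Z Z'_def power2_eq_square algebra_simps)
    also have "\<dots> = 1" unfolding Airy_wronskian c using k by simp
    finally show ?thesis unfolding cmodZ by simp
  qed
  ultimately show ?thesis using g(4)[of x] by (simp add: \<tau>_def k_def)
qed

section \<open>Summation over one block\<close>

lemma norm_cis_diff_le: "norm (cis x - cis y) \<le> \<bar>x - y\<bar>"
proof -
  have "cis x - cis y = cis y * (exp (\<i> * of_real (x - y)) - 1)"
    by (simp add: cis_conv_exp algebra_simps flip: exp_add)
  then have "norm (cis x - cis y) = 2 * \<bar>sin ((x - y) / 2)\<bar>"
    by (simp add: norm_mult dist_exp_i_1 del: of_real_diff)
  also have "\<dots> \<le> 2 * \<bar>(x - y) / 2\<bar>" by (intro mult_left_mono abs_sin_x_le_abs_x) auto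
  finally show ?thesis by simp
qed

text \<open>By the mean value theorem, second differences of \<open>g\<close> are increments of
  \<open>w\<close> over unit intervals, so bounds on increments of \<open>w\<close> replace a second
  derivative. Van der Corput bounds the unweighted partial sums, and summation by parts handles the
  weights.\<close>

lemma weighted_exponential_sum:
  fixes g w :: "real \<Rightarrow> real" and h :: "nat \<Rightarrow> real"
  assumes mN: "m \<le> N"
    and der: "\<And>x. real m \<le> x \<Longrightarrow> (g has_real_derivative w x) (at x)"
    and lower: "\<And>x y. real m \<le> x \<Longrightarrow> x \<le> y \<Longrightarrow> y \<le> real N + 2 \<Longrightarrow> (y - x) * c \<le> w y - w x"
    and upper: "\<And>x y. real m \<le> x \<Longrightarrow> x \<le> y \<Longrightarrow> y \<le> real N + 2 \<Longrightarrow> w y - w x \<le> (y - x) * C"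
    and w: "\<And>x. real m \<le> x \<Longrightarrow> x \<le> real N + 2 \<Longrightarrow> W \<le> w x" "0 < W"
    and c: "0 < c" "0 < \<mu>" "\<mu> * c \<le> 1" and \<alpha>: "0 \<le> \<alpha>"
    and h: "\<And>n. m \<le> n \<Longrightarrow> n < N \<Longrightarrow> \<bar>h (Suc n) - h n\<bar> \<le> H"
  shows "norm (\<Sum>n\<in>{m..<Suc N}. cis (\<mu> * g n + h n) / of_real (w n powr \<alpha>))
    \<le> 16 * (\<mu> * C * real (N - m) + 2) / sqrt (\<mu> * c) * (W powr (- \<alpha>) * (2 + real (N - m) * H))"
proof -
  \<comment> \<open>Taking the unit difference at real arguments makes it differentiable, with an
    increment of \<open>w\<close> as derivative.\<close>
  define G where "G = (\<lambda>t. g (t + 1) - g t)"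
  have derG: "(G has_real_derivative w (x + 1) - w x) (at x)" if "real m \<le> x" for x
    unfolding G_def using der[of x] der[of "x + 1"] that
    by (intro DERIV_diff) (auto simp: DERIV_shift)
  have Gmvt: "\<exists>\<xi>. x < \<xi> \<and> \<xi> < y \<and> G y - G x = (y - x) * (w (\<xi> + 1) - w \<xi>)" if "real m \<le> x" "x < y" for x y
    using MVT2[of x y G "\<lambda>\<xi>. w (\<xi> + 1) - w \<xi>"] derG that by force
  define \<phi> where "\<phi> = (\<lambda>n::nat. \<mu> * g n)"
  have \<phi>G: "\<phi> (Suc n) - \<phi> n = \<mu> * G n" for n
    by (simp add: \<phi>_def G_def algebra_simps)
  have C0: "0 \<le> C"
    using lower[of m "real m + 1"] upper[of m "real m + 1"] mN c by simp
  have sp: "\<phi> (Suc n) - \<phi> n + \<mu> * c \<le> \<phi> (Suc (Suc n)) - \<phi> (Suc n)" if n: "m \<le> n" "n < N" for n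
  proof -
    obtain \<xi> where \<xi>: "real n < \<xi>" "\<xi> < real (Suc n)" "G (Suc n) - G n = w (\<xi> + 1) - w \<xi>"
      using Gmvt[of n "Suc n"] n by auto
    have "c \<le> w (\<xi> + 1) - w \<xi>" using lower[of \<xi> "\<xi> + 1"] \<xi> n by simp
    then have "\<mu> * (G n + c) \<le> \<mu> * G (Suc n)" using \<xi> c by (intro mult_left_mono) auto
    then show ?thesis unfolding \<phi>G by (simp add: algebra_simps)
  qed
  have growth: "\<phi> (Suc n) - \<phi> n \<le> \<phi> (Suc m) - \<phi> m + \<mu> * C * real (N - m)" if n: "m \<le> n" "n \<le> N" for n
  proof (cases "n = m")
    case False
    then obtain \<xi> where \<xi>: "real m < \<xi>" "\<xi> < real n" "G n - G m = (real n - real m) * (w (\<xi> + 1) - w \<xi>)"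
      using Gmvt[of m n] n by auto
    have "w (\<xi> + 1) - w \<xi> \<le> C" using upper[of \<xi> "\<xi> + 1"] \<xi> n by simp
    then have "G n - G m \<le> (real n - real m) * C" unfolding \<xi> using n by (intro mult_left_mono) auto
    also have "\<dots> \<le> real (N - m) * C" using n C0 by (intro mult_right_mono) auto
    finally have "\<mu> * (G n - G m) \<le> \<mu> * (real (N - m) * C)" using c by (intro mult_left_mono) auto
    then show ?thesis unfolding \<phi>G by (simp add: algebra_simps)
  qed (use c C0 in auto)
  define v where "v = (\<lambda>n. cis (h n) * of_real (w n powr (- \<alpha>)))"
  have wpos: "0 < w n" if "m \<le> n" "n \<le> N" for n using w(1)[of n] w(2) that by simp
  have wle: "w n powr (- \<alpha>) \<le> W powr (- \<alpha>)" if "m \<le> n" "n \<le> N" for n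
    using w(1)[of n] w(2) that \<alpha> by (intro powr_mono2') auto
  have wdec: "w (Suc n) powr (- \<alpha>) \<le> w n powr (- \<alpha>)" if n: "m \<le> n" "n < N" for n
  proof (intro powr_mono2')
    have "c \<le> w (Suc n) - w n" using lower[of n "Suc n"] n by simp
    then show "w n \<le> w (Suc n)" using c by simp
  qed (use \<alpha> wpos n in auto)
  have "(\<Sum>n\<in>{m..<Suc N}. cis (\<mu> * g n + h n) / of_real (w n powr \<alpha>)) = (\<Sum>n\<in>{m..<Suc N}. cis (\<phi> n) * v n)"
    by (intro sum.cong) (auto simp: \<phi>_def v_def powr_minus divide_inverse simp flip: cis_mult)
  also have "norm \<dots> \<le> 16 * (\<mu> * C * real (N - m) + 2) / sqrt (\<mu> * c) *
     (norm (v N) + (\<Sum>k\<in>{m..<N}. norm (v (Suc k) - v k)))"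
  proof (rule norm_sum_mult_le[OF mN])
    fix n assume n: "m \<le> n" "n \<le> N"
    show "norm (\<Sum>k\<in>{m..<Suc n}. cis (\<phi> k)) \<le> 16 * (\<mu> * C * real (N - m) + 2) / sqrt (\<mu> * c)"
      using c C0 n by (intro van_der_corput sp growth) auto
  qed
  also have "\<dots> \<le> 16 * (\<mu> * C * real (N - m) + 2) / sqrt (\<mu> * c) * (W powr (- \<alpha>) * (2 + real (N - m) * H))"
  proof (rule mult_left_mono)
    have vN: "norm (v N) \<le> W powr (- \<alpha>)" using wle[of N] mN by (simp add: v_def norm_mult)
    \<comment> \<open>Each step pays \<open>H\<close> for the rotation by \<open>h\<close>, while
      the decreasing amplitude telescopes to at most \<open>W powr (- \<alpha>)\<close>. Together
      with the last weight this gives the 2 in the bound.\<close>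
    have "(\<Sum>k\<in>{m..<N}. norm (v (Suc k) - v k)) \<le>
       (\<Sum>k\<in>{m..<N}. H * W powr (- \<alpha>) + (- (w (Suc k) powr (- \<alpha>)) - - (w k powr (- \<alpha>))))"
    proof (rule sum_mono)
      fix k assume "k \<in> {m..<N}"
      then have k: "m \<le> k" "k < N" by auto
      have "v (Suc k) - v k = (cis (h (Suc k)) - cis (h k)) * of_real (w (Suc k) powr (- \<alpha>))
         + cis (h k) * of_real (w (Suc k) powr (- \<alpha>) - w k powr (- \<alpha>))"
        by (simp add: v_def algebra_simps)
      also have "norm \<dots> \<le> norm (cis (h (Suc k)) - cis (h k)) * w (Suc k) powr (- \<alpha>)
         + \<bar>w (Suc k) powr (- \<alpha>) - w k powr (- \<alpha>)\<bar>"
        by (rule order.trans[OF norm_triangle_ineq]) (simp add: norm_mult flip: of_real_diff)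
      also have "norm (cis (h (Suc k)) - cis (h k)) * w (Suc k) powr (- \<alpha>) \<le> H * W powr (- \<alpha>)"
        using norm_cis_diff_le[of "h (Suc k)" "h k"] h[OF k] wle[of "Suc k"] k
        by (intro mult_mono) (auto intro: order.trans[OF abs_ge_zero])
      also have "\<bar>w (Suc k) powr (- \<alpha>) - w k powr (- \<alpha>)\<bar> = - (w (Suc k) powr (- \<alpha>)) - - (w k powr (- \<alpha>))"
        using wdec[OF k] by simp
      finally show "norm (v (Suc k) - v k) \<le> H * W powr (- \<alpha>) + (- (w (Suc k) powr (- \<alpha>)) - - (w k powr (- \<alpha>)))"
        by simp
    qed
    also have "\<dots> = real (N - m) * (H * W powr (- \<alpha>)) + (w m powr (- \<alpha>) - w N powr (- \<alpha>))"
      unfolding sum.distrib using sum_Suc_diff'[OF mN, of "\<lambda>k. - (w (real k) powr (- \<alpha>))"] by simp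
    also have "\<dots> \<le> real (N - m) * (H * W powr (- \<alpha>)) + W powr (- \<alpha>)"
      using wle[of m] mN powr_ge_zero[of "w N" "- \<alpha>"] by linarith
    finally show "norm (v N) + (\<Sum>k\<in>{m..<N}. norm (v (Suc k) - v k)) \<le> W powr (- \<alpha>) * (2 + real (N - m) * H)"
      using vN by (simp add: algebra_simps)
  qed (use c C0 in auto)
  finally show ?thesis .
qed

section \<open>The phase derivative on a block\<close>

text \<open>In the variable \<open>\<tau>\<close> the derivative is
  \<open>k / airy_phi (\<tau> x)\<close>, and the size condition on \<open>x\<close> reads
  \<open>2 \<le> \<tau> x\<close>. An increment of a reciprocal is the increment of
  \<open>airy_phi\<close> over the product of two values, so the Laplace bounds apply to every
  factor.\<close>

lemma gamma_phase_deriv_bounds: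
  fixes F E :: real
  assumes F: "0 < F" and x: "2 * (F powr (1/3))\<^sup>2 \<le> F * x + E"
  defines "w \<equiv> deriv (gamma_phase F E)"
  shows "sqrt (F * x + E) \<le> w x"
    and "x \<le> y \<Longrightarrow> (y - x) * F * sqrt (F * x + E) / (4 * (F * y + E)) \<le> w y - w x"
    and "x \<le> y \<Longrightarrow> w y - w x \<le> 2 * (y - x) * F * sqrt (F * y + E) / (F * x + E)"
proof -
  define k where "k = F powr (1/3)"
  have k: "0 < k" using F by (simp add: k_def)
  have k3: "F = k ^ 3" using F by (simp add: k_def powr_powr flip: powr_realpow)
  define \<tau> where "\<tau> = (\<lambda>x. k * (x + E / F))"
  have \<tau>: "\<tau> x = (F * x + E) / k\<^sup>2" for x
    using k by (simp add: \<tau>_def k3 field_simps power2_eq_square power3_eq_cube)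
  have w: "w x = k / airy_phi (\<tau> x)" for x
    unfolding w_def using DERIV_imp_deriv[OF gamma_phase_deriv[OF F]] by (simp add: \<tau>_def k_def)
  have sq: "sqrt (F * x + E) = k * sqrt (\<tau> x)" for x
    using k by (simp add: \<tau> real_sqrt_divide)
  have F\<tau>: "F * x + E = k\<^sup>2 * \<tau> x" for x using k by (simp add: \<tau>)
  have two: "2 \<le> \<tau> x" using x k by (simp add: \<tau> field_simps flip: k_def)
  have m: "t powr - (1/2) = 1 / sqrt t" if "2 \<le> t" for t :: real
    using that by (simp add: powr_minus_divide powr_half_sqrt)
  have m3: "t powr - (3/2) = 1 / (t * sqrt t)" if "2 \<le> t" for t :: real
  proof -
    have "t powr (3/2) = t powr (1 + 1/2)" by simp
    also have "\<dots> = t * sqrt t" using that by (simp only: powr_add) (simp add: powr_half_sqrt)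
    finally show ?thesis by (simp add: powr_minus_divide)
  qed
  have up: "1 / airy_phi t \<le> 2 * sqrt t" "sqrt t \<le> 1 / airy_phi t" if "2 \<le> t" for t
    using airy_phi_upper[of t] airy_phi_lower[OF that] airy_phi_pos[of t] that
    by (auto simp: m field_simps)
  show "sqrt (F * x + E) \<le> w x"
    unfolding w sq using mult_left_mono[OF up(2)[OF two], of k] k by simp
  assume xy: "x \<le> y"
  then have \<tau>xy: "\<tau> x \<le> \<tau> y" using k by (simp add: \<tau>_def)
  then have two': "2 \<le> \<tau> y" using two by simp
  have dd: "\<tau> y - \<tau> x = k * (y - x)" by (simp add: \<tau>_def algebra_simps)
  have "0 \<le> (\<tau> y - \<tau> x) * \<tau> y powr (- 3/2) / 4" using \<tau>xy by simp
  also have "\<dots> \<le> airy_phi (\<tau> x) - airy_phi (\<tau> y)"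
    using airy_phi_diff_lower[of "\<tau> x" "\<tau> y"] two two' \<tau>xy by simp
  finally have pos: "0 \<le> airy_phi (\<tau> x) - airy_phi (\<tau> y)" .
  have dw: "w y - w x = k * ((airy_phi (\<tau> x) - airy_phi (\<tau> y)) * ((1 / airy_phi (\<tau> x)) * (1 / airy_phi (\<tau> y))))"
    using airy_phi_pos[of "\<tau> x"] airy_phi_pos[of "\<tau> y"] by (simp add: w field_simps)
  have s: "0 < sqrt (\<tau> x)" "0 < sqrt (\<tau> y)" using two two' by auto
  show "(y - x) * F * sqrt (F * x + E) / (4 * (F * y + E)) \<le> w y - w x"
  proof -
    have "(y - x) * F * sqrt (F * x + E) / (4 * (F * y + E)) = k * ((k * (y - x)) * (1 / (\<tau> y * sqrt (\<tau> y))) / 4 * (sqrt (\<tau> x) * sqrt (\<tau> y)))"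
      unfolding sq unfolding F\<tau> using k s two' by (simp add: k3 field_simps power2_eq_square power3_eq_cube)
    also have "\<dots> \<le> w y - w x" unfolding dw
      using airy_phi_diff_lower[of "\<tau> x" "\<tau> y"] two two' \<tau>xy up(2)[OF two] up(2)[OF two'] k xy s pos
      by (intro mult_left_mono mult_mono) (auto simp: dd m3 airy_phi_pos less_imp_le)
    finally show ?thesis .
  qed
  show "w y - w x \<le> 2 * (y - x) * F * sqrt (F * y + E) / (F * x + E)"
  proof -
    have "w y - w x \<le> k * ((k * (y - x)) * (1 / (\<tau> x * sqrt (\<tau> x))) / 2 * ((2 * sqrt (\<tau> x)) * (2 * sqrt (\<tau> y))))"
      unfolding dw
      using airy_phi_diff_upper[of "\<tau> x" "\<tau> y"] two two' \<tau>xy up(1)[OF two] up(1)[OF two'] k xy s pos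
      by (intro mult_left_mono mult_mono) (auto simp: dd m3 airy_phi_pos less_imp_le)
    also have "\<dots> = 2 * (y - x) * F * sqrt (F * y + E) / (F * x + E)"
      unfolding sq unfolding F\<tau> using k s two by (simp add: k3 field_simps power2_eq_square power3_eq_cube)
    finally show ?thesis .
  qed
qed

text \<open>Rounding up and subtracting one half moves a point by at most one half.\<close>

lemma x_pt_bounds:
  assumes "0 < F"
  shows "pi\<^sup>2 * (real l - 1/2)\<^sup>2 - F / 2 \<le> F * x_pt F l"
    and "F * x_pt F l \<le> pi\<^sup>2 * (real l - 1/2)\<^sup>2 + F / 2"
proof -
  define q where "q = pi\<^sup>2 / F * (real l - 1/2)\<^sup>2"
  have Fq: "F * q = pi\<^sup>2 * (real l - 1/2)\<^sup>2" using assms by (simp add: q_def)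
  have "q - 1/2 \<le> x_pt F l" "x_pt F l \<le> q + 1/2" unfolding x_pt_def q_def[symmetric] by linarith+
  then have "F * (q - 1/2) \<le> F * x_pt F l" "F * x_pt F l \<le> F * (q + 1/2)"
    using assms by (auto intro!: mult_left_mono)
  then show "pi\<^sup>2 * (real l - 1/2)\<^sup>2 - F / 2 \<le> F * x_pt F l"
    "F * x_pt F l \<le> pi\<^sup>2 * (real l - 1/2)\<^sup>2 + F / 2"
    by (simp_all add: algebra_simps Fq)
qed

text \<open>A single \<open>R\<close> controls all parameters. On the block \<open>F * x + E\<close>
  is of order \<open>l^2\<close>; the margin 2 leaves room for the differences that reach past its
  right end.\<close>

lemma phase_block_bounds:
  fixes F E R :: real
  assumes R: "1 \<le> R" and F: "1 / R \<le> F" "F \<le> R" and E: "\<bar>E\<bar> \<le> R" and l: "4 * R \<le> real l"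
  shows "x_pt F (Suc l) - x_pt F l \<le> 33 * R * real l"
    and "x_pt F l \<le> x \<Longrightarrow> (real l)\<^sup>2 \<le> F * x + E"
    and "x \<le> x_pt F (Suc l) + 2 \<Longrightarrow> F * x + E \<le> (7 * real l)\<^sup>2"
    and "x_pt F l \<le> x \<Longrightarrow> (real l)\<^sup>2 / (2 * R) \<le> x"
    and "x_pt F l \<le> x \<Longrightarrow> 2 * (F powr (1/3))\<^sup>2 \<le> F * x + E"
proof -
  define L where "L = real l"
  have L: "4 * R \<le> L" "4 \<le> L" using l R by (auto simp: L_def)
  have F0: "0 < F" using F R by (smt (verit) divide_pos_pos)
  have FR: "1 \<le> F * R" using F R by (simp add: field_simps)
  have pi9: "9 \<le> pi\<^sup>2" using power_mono[of 3 pi 2] pi_gt3 by simp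
  have pi16: "pi\<^sup>2 \<le> 16" using power_mono[of pi 4 2] pi_less_4 by simp
  \<comment> \<open>This absorbs the errors from rounding and from \<open>E\<close>, all of order
    \<open>R\<close>, into multiples of \<open>L^2\<close>.\<close>
  have LR: "16 * R \<le> L\<^sup>2"
    using mult_mono[of "4 * R" L 4 L] L R by (simp add: power2_eq_square)
  have xl: "pi\<^sup>2 * (L - 1/2)\<^sup>2 - F / 2 \<le> F * x_pt F l"
    and xu: "F * x_pt F (Suc l) \<le> pi\<^sup>2 * (L + 1/2)\<^sup>2 + F / 2"
    using x_pt_bounds[OF F0, of l] x_pt_bounds[OF F0, of "Suc l"] by (simp_all add: L_def add.commute)
  show "x_pt F (Suc l) - x_pt F l \<le> 33 * R * real l"
  proof -
    define d where "d = x_pt F (Suc l) - x_pt F l"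
    have "F * d \<le> pi\<^sup>2 * (2 * L) + F"
      using xl xu by (simp add: d_def power2_eq_square algebra_simps)
    also have "\<dots> \<le> 16 * (2 * L) + F" using pi16 L by (intro add_right_mono mult_right_mono) auto
    also have "\<dots> \<le> 32 * L * (F * R) + F * 1" using FR L by (simp add: mult_le_cancel_left1)
    also have "\<dots> = F * (32 * L * R + 1)" by (simp add: algebra_simps)
    finally have "d \<le> 32 * L * R + 1" using F0 by simp
    also have "1 \<le> L * R" using L R mult_mono[of 1 L 1 R] by simp
    finally show ?thesis by (simp add: d_def L_def algebra_simps)
  qed
  show lo: "(real l)\<^sup>2 \<le> F * x + E" if x: "x_pt F l \<le> x" for x
  proof -
    have "9 * (L / 2)\<^sup>2 \<le> pi\<^sup>2 * (L - 1/2)\<^sup>2" using pi9 L by (intro mult_mono power_mono) auto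
    moreover have "F * x_pt F l \<le> F * x" using x F0 by simp
    ultimately have "9 * (L / 2)\<^sup>2 - F / 2 + E \<le> F * x + E" using xl by linarith
    moreover have "9 * (L / 2)\<^sup>2 = 9/4 * L\<^sup>2" by (simp add: power2_eq_square)
    ultimately show ?thesis using LR F E unfolding L_def[symmetric] by linarith
  qed
  show "F * x + E \<le> (7 * real l)\<^sup>2" if x: "x \<le> x_pt F (Suc l) + 2"
  proof -
    have "pi\<^sup>2 * (L + 1/2)\<^sup>2 \<le> 16 * (3/2 * L)\<^sup>2" using pi16 L by (intro mult_mono power_mono) auto
    moreover have "F * x \<le> F * x_pt F (Suc l) + 2 * F"
      using mult_left_mono[OF x, of F] F0 by (simp add: algebra_simps)
    ultimately have "F * x + E \<le> 16 * (3/2 * L)\<^sup>2 + F / 2 + 2 * F + E" using xu by linarith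
    moreover have "16 * (3/2 * L)\<^sup>2 = 36 * L\<^sup>2" "(7 * L)\<^sup>2 = 49 * L\<^sup>2" by (simp_all add: power2_eq_square)
    ultimately show ?thesis using LR F E unfolding L_def[symmetric] by linarith
  qed
  show "(real l)\<^sup>2 / (2 * R) \<le> x" if x: "x_pt F l \<le> x"
  proof -
    have "L\<^sup>2 / 2 \<le> F * x" using lo[OF x] LR E unfolding L_def[symmetric] by linarith
    moreover have "0 \<le> x" using calculation F0 by (smt (verit) zero_le_power2 mult_pos_neg divide_nonneg_pos)
    then have "F * x \<le> R * x" using F by (intro mult_right_mono) auto
    ultimately show ?thesis using R by (simp add: L_def field_simps)
  qed
  show "2 * (F powr (1/3))\<^sup>2 \<le> F * x + E" if x: "x_pt F l \<le> x"
  proof -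
    have "F powr (1/3) \<le> R powr 1"
      using F F0 R powr_mono2[of "1/3" F R] powr_mono[of "1/3" 1 R] by simp
    then have "(F powr (1/3))\<^sup>2 \<le> R\<^sup>2" using R by (intro power_mono) auto
    moreover have "(4 * R)\<^sup>2 \<le> L\<^sup>2" using L R by (intro power_mono) auto
    then have "16 * R\<^sup>2 \<le> L\<^sup>2" by (simp add: power_mult_distrib)
    ultimately show ?thesis using lo[OF x] zero_le_power2[of R] unfolding L_def[symmetric] by linarith
  qed
qed

text \<open>\<open>weighted_exponential_sum\<close> is applied with \<open>W = L\<close>, second
  differences of order \<open>1 / L\<close> and a block length of order \<open>L\<close>. Van der
  Corput then contributes the square root of \<open>L\<close>, and \<open>h\<close> has variation of
  order \<open>L * L powr (- 2 * \<beta>)\<close>.\<close>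

lemma block_sum_bound:
  fixes F E \<alpha> \<beta> \<mu> C R :: real and h :: "nat \<Rightarrow> real"
  assumes R: "1 \<le> R" and F: "1 / R \<le> F" "F \<le> R" and E: "\<bar>E\<bar> \<le> R" and l: "4 * R \<le> real l"
    and \<alpha>: "0 \<le> \<alpha>" and \<beta>: "0 \<le> \<beta>" "\<beta> \<le> R" and \<mu>: "1 / R \<le> \<mu>" "\<mu> \<le> R" and C: "0 \<le> C" "C \<le> R"
    and h: "\<And>n. x_pt F l \<le> real n \<Longrightarrow> real n \<le> x_pt F (Suc l) \<Longrightarrow> \<bar>h (Suc n) - h n\<bar> \<le> C * real n powr (- \<beta>)"
    and ab: "x_pt F l \<le> a" "a < b" "b \<le> x_pt F (Suc l)"
  shows "cmod (\<Sum>n\<in>{n :: nat. a < real n \<and> real n \<le> b}.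
      cis (\<mu> * gamma_phase F E (real n) + h n) / of_real (deriv (gamma_phase F E) (real n) powr \<alpha>))
    \<le> 224 * R * (462 * R ^ 3 + 2) * (2 + 33 * R\<^sup>2 * (2 * R) powr R)
       * real l powr (- \<alpha> + 1/2) * (1 + real l powr (1 - 2 * \<beta>))"
    (is "cmod (sum ?f ?S) \<le> ?M * _ * _")
proof -
  define L where "L = real l"
  have L: "4 * R \<le> L" "4 \<le> L" using l R by (auto simp: L_def)
  have F0: "0 < F" using F R by (smt (verit) divide_pos_pos)
  have \<mu>0: "0 < \<mu>" using \<mu> R by (smt (verit) divide_pos_pos)
  note block = phase_block_bounds[OF R F E l]
  have a0: "0 \<le> a"
  proof -
    have "0 \<le> (real l)\<^sup>2 / (2 * R)" using R by simp
    also have "\<dots> \<le> a" by (rule block(4)[OF ab(1)])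
    finally show ?thesis .
  qed
  \<comment> \<open>These are the first integer beyond \<open>a\<close> and the last one up to
    \<open>b\<close>; \<open>0 \<le> a\<close> keeps \<open>nat\<close> from truncating.\<close>
  define m N where "m = Suc (nat \<lfloor>a\<rfloor>)" and "N = nat \<lfloor>b\<rfloor>"
  have m: "a < real m" and N: "real N \<le> b" using a0 ab by (auto simp: m_def N_def) linarith
  have S: "?S = {m..<Suc N}"
  proof (intro set_eqI)
    fix n :: nat
    have "a < real n \<longleftrightarrow> m \<le> n" unfolding m_def Suc_le_eq using a0 by (simp add: nat_less_iff floor_less_iff)
    moreover have "real n \<le> b \<longleftrightarrow> n < Suc N"
      unfolding N_def less_Suc_eq_le using a0 ab by (simp add: le_nat_iff le_floor_iff)
    ultimately show "n \<in> ?S \<longleftrightarrow> n \<in> {m..<Suc N}" by simp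
  qed
  have M0: "0 \<le> ?M * real l powr (- \<alpha> + 1/2) * (1 + real l powr (1 - 2 * \<beta>))"
    using R by (intro mult_nonneg_nonneg add_nonneg_nonneg) auto
  show ?thesis
  proof (cases "m \<le> N")
    case False
    then have "{m..<Suc N} = {}" by simp
    then show ?thesis using M0 unfolding S by (simp only: sum.empty norm_zero)
  next
    case True
    define w where "w = deriv (gamma_phase F E)"
    \<comment> \<open>From \<open>F \<ge> 1 / R\<close> and
      \<open>F * y + E \<le> (7 * L)^2\<close>, with \<open>196 = 4 * 49\<close>.\<close>
    define c where "c = 1 / (196 * R * L)"
    \<comment> \<open>From \<open>n \<ge> L^2 / (2 * R)\<close>, with the exponent of
      \<open>2 * R\<close> enlarged from \<open>\<beta>\<close> to \<open>R\<close>.\<close>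
    define H where "H = R * ((2 * R) powr R * L powr (- 2 * \<beta>))"
    have xm: "x_pt F l \<le> x" if "real m \<le> x" for x using that m ab by linarith
    have xN: "x \<le> x_pt F (Suc l) + 2" if "x \<le> real N + 2" for x using that N ab by linarith
    have sqrt_lo: "L \<le> sqrt (F * x + E)" if "real m \<le> x" for x
      using block(2)[OF xm[OF that]] L unfolding L_def[symmetric] by (simp add: real_le_rsqrt)
    have sqrt_hi: "sqrt (F * x + E) \<le> 7 * L" if "x \<le> real N + 2" for x
      using block(3)[OF xN[OF that]] L unfolding L_def[symmetric] by (simp add: real_le_lsqrt)
    have Lsq: "0 < L\<^sup>2" using L by simp
    have "cmod (\<Sum>n\<in>{m..<Suc N}. cis (\<mu> * gamma_phase F E (real n) + h n) / of_real (w (real n) powr \<alpha>))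
      \<le> 16 * (\<mu> * (14 * R / L) * real (N - m) + 2) / sqrt (\<mu> * c) * (L powr (- \<alpha>) * (2 + real (N - m) * H))"
    proof (rule weighted_exponential_sum[OF True])
      fix x :: real assume x: "real m \<le> x"
      show "(gamma_phase F E has_real_derivative w x) (at x)"
        unfolding w_def using gamma_phase_deriv[OF F0] DERIV_imp_deriv by metis
      show "L \<le> w x" unfolding w_def
        using gamma_phase_deriv_bounds(1)[OF F0 block(5)[OF xm[OF x]]] sqrt_lo[OF x] by linarith
      fix y assume y: "x \<le> y" "y \<le> real N + 2"
      have Fx: "L\<^sup>2 \<le> F * x + E" and Fy: "L\<^sup>2 \<le> F * y + E" "F * y + E \<le> (7 * L)\<^sup>2"
        using block(2)[OF xm] block(3)[OF xN] x y unfolding L_def by auto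
      have "0 < F * x + E" "0 < F * y + E" using Fx Fy(1) Lsq by linarith+
      then have pos: "0 < F * x + E" "0 < F * y + E" "0 < 4 * (F * y + E)" by (auto intro: mult_pos_pos)
      show "(y - x) * c \<le> w y - w x"
      proof -
        have "(y - x) * c = (y - x) * (1 / R) * L / (4 * (7 * L)\<^sup>2)"
          using L R by (simp add: c_def power2_eq_square field_simps)
        also have "\<dots> \<le> (y - x) * F * sqrt (F * x + E) / (4 * (F * y + E))"
          using F sqrt_lo[OF x] Fy Lsq x y L R F0 pos by (intro frac_le mult_mono mult_nonneg_nonneg) auto
        also have "\<dots> \<le> w y - w x" unfolding w_def
          by (rule gamma_phase_deriv_bounds(2)[OF F0 block(5)[OF xm[OF x]] y(1)])
        finally show ?thesis .
      qed
      show "w y - w x \<le> (y - x) * (14 * R / L)"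
      proof -
        have "w y - w x \<le> 2 * (y - x) * F * sqrt (F * y + E) / (F * x + E)" unfolding w_def
          by (rule gamma_phase_deriv_bounds(3)[OF F0 block(5)[OF xm[OF x]] y(1)])
        also have "\<dots> \<le> 2 * (y - x) * R * (7 * L) / L\<^sup>2"
          using F sqrt_hi[OF y(2)] Fx Fy Lsq x y L R F0 pos by (intro frac_le mult_mono mult_nonneg_nonneg) auto
        also have "\<dots> = (y - x) * (14 * R / L)" using L by (simp add: power2_eq_square field_simps)
        finally show ?thesis .
      qed
    next
      show "\<mu> * c \<le> 1"
      proof -
        have "\<mu> * c \<le> R * c" using \<mu> L R by (intro mult_right_mono) (auto simp: c_def)
        also have "\<dots> \<le> 1" using L R by (simp add: c_def)
        finally show ?thesis .
      qed
    next
      fix n assume n: "m \<le> n" "n < N"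
      have xn: "x_pt F l \<le> real n" "real n \<le> x_pt F (Suc l)" using xm[of n] n N ab by auto
      have "real n powr (- \<beta>) \<le> (L\<^sup>2 / (2 * R)) powr (- \<beta>)"
        using block(4)[OF xn(1)] \<beta> Lsq R unfolding L_def by (intro powr_mono2') auto
      also have "\<dots> = (2 * R) powr \<beta> * L powr (- 2 * \<beta>)"
      proof -
        have "L\<^sup>2 = L powr 2" using L by simp
        then have "(L\<^sup>2 / (2 * R)) powr (- \<beta>) = (L powr 2) powr (- \<beta>) / (2 * R) powr (- \<beta>)"
          by (simp only: powr_divide)
        then show ?thesis by (simp add: powr_powr powr_minus field_simps)
      qed
      also have "\<dots> \<le> (2 * R) powr R * L powr (- 2 * \<beta>)"
        using \<beta> R by (intro mult_right_mono powr_mono) auto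
      finally have "C * real n powr (- \<beta>) \<le> H"
        unfolding H_def using C by (intro mult_mono) auto
      then show "\<bar>h (Suc n) - h n\<bar> \<le> H" using h[OF xn] by linarith
    qed (use L R \<mu>0 \<alpha> in \<open>auto simp: c_def\<close>)
    \<comment> \<open>The total growth of the phase differences is at most
      \<open>462 * R ^ 3\<close>, with \<open>462 = 14 * 33\<close>, and
      \<open>\<mu> * c \<ge> 1 / (14 * R * sqrt L)^2\<close> is the source of the exponent
      1/2.\<close>
    also have "\<dots> \<le> 16 * (462 * R ^ 3 + 2) / (1 / (14 * R * sqrt L)) * (L powr (- \<alpha>) * (2 + 33 * R * L * H))"
    proof -
      have H0: "0 \<le> H" using R by (simp add: H_def)
      have Nm: "real (N - m) \<le> 33 * R * L"
        using block(1) m N ab True unfolding L_def by (simp add: of_nat_diff)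
      have "\<mu> * (14 * R / L) * real (N - m) \<le> R * (14 * R / L) * (33 * R * L)"
        using \<mu> \<mu>0 R L Nm by (intro mult_mono) auto
      also have "\<dots> = 462 * R ^ 3" using L by (simp add: power3_eq_cube)
      finally have 1: "16 * (\<mu> * (14 * R / L) * real (N - m) + 2) \<le> 16 * (462 * R ^ 3 + 2)" by simp
      have 2: "1 / (14 * R * sqrt L) \<le> sqrt (\<mu> * c)"
      proof (rule real_le_rsqrt)
        have "(1 / (14 * R * sqrt L))\<^sup>2 = 1 / R * c"
          using L R by (simp add: c_def power_divide power_mult_distrib power2_eq_square)
        also have "\<dots> \<le> \<mu> * c" using \<mu> L R by (intro mult_right_mono) (auto simp: c_def)
        finally show "(1 / (14 * R * sqrt L))\<^sup>2 \<le> \<mu> * c" .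
      qed
      have 3: "2 + real (N - m) * H \<le> 2 + 33 * R * L * H"
        using Nm H0 by (intro add_left_mono mult_right_mono) auto
      have 5: "0 \<le> \<mu> * (14 * R) * real (N - m) / L + 2"
        using \<mu>0 R L by (intro add_nonneg_nonneg divide_nonneg_nonneg mult_nonneg_nonneg) auto
      have 4: "0 < 1 / (14 * R * sqrt L)" using R L by simp
      show ?thesis
      proof (intro mult_mono frac_le)
        show "0 \<le> 16 * (462 * R ^ 3 + 2) / (1 / (14 * R * sqrt L))" using R L by simp
      qed (use 1 2 3 4 5 H0 R in auto)
    qed
    also have "\<dots> = 224 * R * (462 * R ^ 3 + 2) * (sqrt L * L powr (- \<alpha>)) * (2 + 33 * R\<^sup>2 * (2 * R) powr R * (L * L powr (- 2 * \<beta>)))"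
    proof -
      have "16 * A / (1 / (14 * R * s)) * (W * (2 + 33 * R * L * (R * (P * Q)))) =
        224 * R * A * (s * W) * (2 + 33 * R\<^sup>2 * P * (L * Q))" for A s W P Q :: real
        by (simp add: power2_eq_square algebra_simps)
      then show ?thesis unfolding H_def .
    qed
    also have "sqrt L * L powr (- \<alpha>) = L powr (- \<alpha> + 1/2)"
      using L by (simp only: powr_add) (simp add: powr_half_sqrt)
    also have "L * L powr (- 2 * \<beta>) = L powr (1 - 2 * \<beta>)"
      using L powr_mult_base[of L "- 2 * \<beta>"] by simp
    also have "224 * R * (462 * R ^ 3 + 2) * L powr (- \<alpha> + 1/2) * (2 + 33 * R\<^sup>2 * (2 * R) powr R * L powr (1 - 2 * \<beta>))
       \<le> 224 * R * (462 * R ^ 3 + 2) * L powr (- \<alpha> + 1/2) * ((2 + 33 * R\<^sup>2 * (2 * R) powr R) * (1 + L powr (1 - 2 * \<beta>)))"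
      using R by (intro mult_left_mono) (auto simp: algebra_simps)
    finally show ?thesis unfolding S w_def L_def by (simp only: mult.assoc mult.commute mult.left_commute)
  qed
qed

section \<open>Uniformity over a compact parameter set\<close>

theorem theorem5p3:
  fixes K :: "(real \<times> real \<times> real \<times> real \<times> real \<times> real) set"
  assumes "compact K"
    and "\<forall>(F, E, \<alpha>, \<beta>, \<mu>, C) \<in> K. F > 0 \<and> \<alpha> \<ge> 0 \<and> \<beta> > 0 \<and> \<mu> > 0 \<and> C > 0"
  shows "\<exists>M L0. \<forall>(F, E, \<alpha>, \<beta>, \<mu>, C) \<in> K. \<forall>h :: nat \<Rightarrow> real. \<forall>l :: nat. l \<ge> L0 \<longrightarrow>
     (\<forall>n :: nat. x_pt F l \<le> real n \<and> real n \<le> x_pt F (Suc l) \<longrightarrow>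
        \<bar>h (Suc n) - h n\<bar> \<le> C * real n powr (- \<beta>)) \<longrightarrow>
     (\<forall>a b. x_pt F l \<le> a \<and> a < b \<and> b \<le> x_pt F (Suc l) \<longrightarrow>
        cmod (\<Sum>n \<in> {n :: nat. a < real n \<and> real n \<le> b}.
              cis (\<mu> * gamma_phase F E (real n) + h n)
              / complex_of_real (deriv (gamma_phase F E) (real n) powr \<alpha>))
        \<le> M * real l powr (- \<alpha> + 1/2) * (1 + real l powr (1 - 2 * \<beta>)))"
proof -
  \<comment> \<open>This function dominates the sizes entering the block estimate, including the
    reciprocals of \<open>F\<close> and \<open>\<mu>\<close>. It is continuous where these are
    positive, so compactness of \<open>K\<close> bounds it.\<close>
  define s :: "real \<times> real \<times> real \<times> real \<times> real \<times> real \<Rightarrow> real"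
    where "s = (\<lambda>(F, E, \<alpha>, \<beta>, \<mu>, C). 1 + F + 1 / F + \<bar>E\<bar> + \<beta> + \<mu> + 1 / \<mu> + C)"
  have "continuous_on K s"
    using assms(2) unfolding s_def case_prod_beta by (intro continuous_intros) fastforce+
  then have "bounded (s ` K)"
    using assms(1) by (intro compact_imp_bounded compact_continuous_image)
  then obtain R0 where R0: "\<And>p. p \<in> K \<Longrightarrow> s p \<le> R0"
    unfolding bounded_real by (metis abs_le_D1 imageI)
  define R where "R = max 1 R0"
  show ?thesis
  \<comment> \<open>The witnesses are left open and are fixed below as
    \<open>nat \<lceil>4 * R\<rceil>\<close> and the constant of \<open>block_sum_bound\<close>;
    both depend on \<open>R\<close> alone.\<close>
  proof (intro exI ballI, clarify)
    fix F E \<alpha> \<beta> \<mu> C :: real and h :: "nat \<Rightarrow> real" and l :: nat and a b :: real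
    assume K: "(F, E, \<alpha>, \<beta>, \<mu>, C) \<in> K" and l: "nat \<lceil>4 * R\<rceil> \<le> l"
      and h: "\<forall>n. x_pt F l \<le> real n \<and> real n \<le> x_pt F (Suc l) \<longrightarrow> \<bar>h (Suc n) - h n\<bar> \<le> C * real n powr (- \<beta>)"
      and ab: "x_pt F l \<le> a" "a < b" "b \<le> x_pt F (Suc l)"
    have pos: "F > 0" "\<alpha> \<ge> 0" "\<beta> > 0" "\<mu> > 0" "C > 0" using assms(2) K by auto
    have "1 + F + 1 / F + \<bar>E\<bar> + \<beta> + \<mu> + 1 / \<mu> + C \<le> R"
      using R0[OF K] by (simp add: s_def R_def)
    moreover have "0 < 1 / F" "0 < 1 / \<mu>" using pos by auto
    ultimately have b: "1 / F \<le> R" "F \<le> R" "\<bar>E\<bar> \<le> R" "\<beta> \<le> R" "1 / \<mu> \<le> R" "\<mu> \<le> R" "C \<le> R" "1 \<le> R"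
      using pos abs_ge_zero[of E] R_def by linarith+
    then have "1 / R \<le> F" "1 / R \<le> \<mu>" using pos by (simp_all add: field_simps)
    moreover have "4 * R \<le> real l" using l by linarith
    ultimately show "cmod (\<Sum>n \<in> {n :: nat. a < real n \<and> real n \<le> b}.
              cis (\<mu> * gamma_phase F E (real n) + h n)
              / complex_of_real (deriv (gamma_phase F E) (real n) powr \<alpha>))
        \<le> 224 * R * (462 * R ^ 3 + 2) * (2 + 33 * R\<^sup>2 * (2 * R) powr R)
          * real l powr (- \<alpha> + 1/2) * (1 + real l powr (1 - 2 * \<beta>))"
      using b pos h ab by (intro block_sum_bound[where C = C]) auto
  qed
qed

end
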